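(* For any $n\ge0$, $\mathcal{V}_n=\mathbf{H}\mathbf{S}\mathbf{P}\,\mathscr{C}_n^+=\mathbf{S}\mathbf{P}_U\,\mathscr{C}_n^+$. In particular every algebra in $\mathcal{V}_n$ is isomorphic to a subalgebra of an ultraproduct of members of $\mathscr{C}_n^+$.
   Context: A normal modal algebra is $(\mathbf{B},f)$ with $\mathbf{B}$ a Boolean algebra and $f$ a unary operation preserving all finite meets (including $f(1)=1$). Modal formulas (built from variables by $\top,\neg,\wedge,\Box$, $\Diamond=\neg\Box\neg$, $\Box^*\varphi=\varphi\wedge\Box\varphi$) are terms with $\Box$ denoting $f$; $\varphi$ is valid in an algebra if the equation $\varphi\approx\top$ holds in it. A normal logic is a set of formulas containing all tautologies and all instances of $\Box(\varphi\to\psi)\to(\Box\varphi\to\Box\psi)$, closed under modus ponens, $\Box$-generalisation and uniform substitution. Define $\mathbb{P}_0(\varphi_0)=\Diamond\varphi_0$, $\mathbb{P}_n(\varphi_0,\dots,\varphi_n)=\Diamond(\varphi_1\wedge\mathbb{P}_{n-1}(\varphi_0,\varphi_2,\dots,\varphi_n))$ for $n>0$; $\mathbb{D}_n=\bigwedge_{i<j\le n}\neg(\varphi_i\wedge\varphi_j)$ ($=\top$ if $n=0$); $\mathbb{C}_n$ is the scheme $\Box^*\mathbb{D}_n\to(\Diamond\varphi_0\to\Diamond(\varphi_0\wedge\neg\mathbb{P}_n))$; $\mathrm{K4}\mathbb{C}_n$ is the smallest normal logic containing all instances of $\Box\varphi\to\Box\Box\varphi$ and of $\mathbb{C}_n$.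 $\mathcal{V}_n$ is the variety of all normal modal algebras validating every theorem of $\mathrm{K4}\mathbb{C}_n$. For a frame $\mathcal{F}=(W,R)$, its complex algebra is $\mathcal{F}^+=(\mathcal{P}W,[R])$ with $[R]X=\{x:\forall y(xRy\Rightarrow y\in X)\}$. $\mathscr{C}_n$ is the class of all finite transitive frames of circumference at most $n$ (circumference: supremum of lengths $m$ of cycles, i.e. sequences of $m$ distinct points $x_0,\dots,x_{m-1}$ with $x_0R\cdots Rx_{m-1}Rx_0$; 0 if none), and $\mathscr{C}_n^+=\{\mathcal{F}^+:\mathcal{F}\in\mathscr{C}_n\}$. $\mathbf{H},\mathbf{S},\mathbf{P},\mathbf{P}_U$ denote closure under homomorphic images, isomorphic copies of subalgebras, direct products and ultraproducts respectively. *)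

theory Defs
  imports Main "HOL-Library.FuncSet" "HOL-Library.Extended_Nat"
begin

section \<open>Modal formulas and the logics K4C\<close>

datatype fm = Var nat | Top | Neg fm | And fm fm | Box fm

abbreviation Imp :: "fm \<Rightarrow> fm \<Rightarrow> fm" where
  "Imp \<phi> \<psi> \<equiv> Neg (And \<phi> (Neg \<psi>))"

abbreviation Dia :: "fm \<Rightarrow> fm" where
  "Dia \<phi> \<equiv> Neg (Box (Neg \<phi>))"

abbreviation Boxstar :: "fm \<Rightarrow> fm" where
  "Boxstar \<phi> \<equiv> And \<phi> (Box \<phi>)"

primrec subst :: "(nat \<Rightarrow> fm) \<Rightarrow> fm \<Rightarrow> fm" where
  "subst \<sigma> (Var k) = \<sigma> k"
| "subst \<sigma> Top = Top"
| "subst \<sigma> (Neg \<phi>) = Neg (subst \<sigma> \<phi>)"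
| "subst \<sigma> (And \<phi> \<psi>) = And (subst \<sigma> \<phi>) (subst \<sigma> \<psi>)"
| "subst \<sigma> (Box \<phi>) = Box (subst \<sigma> \<phi>)"

text \<open>Boxed subformulas are treated as atoms, so that the tautologies are exactly the
  modal formulas that are substitution instances of propositional tautologies.\<close>

primrec prop_eval :: "(fm \<Rightarrow> bool) \<Rightarrow> fm \<Rightarrow> bool" where
  "prop_eval v (Var k) = v (Var k)"
| "prop_eval v Top = True"
| "prop_eval v (Neg \<phi>) = (\<not> prop_eval v \<phi>)"
| "prop_eval v (And \<phi> \<psi>) = (prop_eval v \<phi> \<and> prop_eval v \<psi>)"
| "prop_eval v (Box \<phi>) = v (Box \<phi>)"

definition tautology :: "fm \<Rightarrow> bool" where
  "tautology \<phi> \<longleftrightarrow> (\<forall>v. prop_eval v \<phi>)"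

definition normal_logic :: "fm set \<Rightarrow> bool" where
  "normal_logic L \<longleftrightarrow>
     (\<forall>\<phi>. tautology \<phi> \<longrightarrow> \<phi> \<in> L) \<and>
     (\<forall>\<phi> \<psi>. Imp (Box (Imp \<phi> \<psi>)) (Imp (Box \<phi>) (Box \<psi>)) \<in> L) \<and>
     (\<forall>\<phi> \<psi>. \<phi> \<in> L \<longrightarrow> Imp \<phi> \<psi> \<in> L \<longrightarrow> \<psi> \<in> L) \<and>
     (\<forall>\<phi>. \<phi> \<in> L \<longrightarrow> Box \<phi> \<in> L) \<and>
     (\<forall>\<phi> \<sigma>. \<phi> \<in> L \<longrightarrow> subst \<sigma> \<phi> \<in> L)"

text \<open>\<open>fmP p0 [p1, ..., pn]\<close> is $P_n(p_0,p_1,\dots,p_n)$, and similarly \<open>fmD n p\<close> and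
  \<open>fmC n p\<close> use only \<open>p 0, ..., p n\<close>.\<close>

fun fmP :: "fm \<Rightarrow> fm list \<Rightarrow> fm" where
  "fmP \<phi>0 [] = Dia \<phi>0"
| "fmP \<phi>0 (\<phi> # \<phi>s) = Dia (And \<phi> (fmP \<phi>0 \<phi>s))"

definition fmD :: "nat \<Rightarrow> (nat \<Rightarrow> fm) \<Rightarrow> fm" where
  "fmD n \<phi> = foldr And [Neg (And (\<phi> i) (\<phi> j)). j \<leftarrow> [0..<Suc n], i \<leftarrow> [0..<j]] Top"

definition fmC :: "nat \<Rightarrow> (nat \<Rightarrow> fm) \<Rightarrow> fm" where
  "fmC n \<phi> = Imp (Boxstar (fmD n \<phi>))
     (Imp (Dia (\<phi> 0)) (Dia (And (\<phi> 0) (Neg (fmP (\<phi> 0) (map \<phi> [1..<Suc n]))))))"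

definition K4C :: "nat \<Rightarrow> fm set" where
  "K4C n = \<Inter> {L. normal_logic L \<and> (\<forall>\<phi>. Imp (Box \<phi>) (Box (Box \<phi>)) \<in> L) \<and>
     (\<forall>\<phi>. fmC n \<phi> \<in> L)}"

section \<open>Normal modal algebras\<close>

text \<open>Only the behaviour of the operations on the carrier is relevant.\<close>

record 'a modal_algebra =
  carrier :: "'a set"
  meet :: "'a \<Rightarrow> 'a \<Rightarrow> 'a"
  join :: "'a \<Rightarrow> 'a \<Rightarrow> 'a"
  cmpl :: "'a \<Rightarrow> 'a"
  zero :: 'a
  one :: 'a
  box :: "'a \<Rightarrow> 'a"

definition subuniverse :: "'a set \<Rightarrow> 'a modal_algebra \<Rightarrow> bool" where
  "subuniverse X A \<longleftrightarrow> X \<subseteq> carrier A \<and> zero A \<in> X \<and> one A \<in> X \<and>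
     (\<forall>x\<in>X. cmpl A x \<in> X \<and> box A x \<in> X) \<and>
     (\<forall>x\<in>X. \<forall>y\<in>X. meet A x y \<in> X \<and> join A x y \<in> X)"

abbreviation algebra_closed :: "'a modal_algebra \<Rightarrow> bool" where
  "algebra_closed A \<equiv> subuniverse (carrier A) A"

text \<open>The Boolean axioms are those of \<^locale>\<open>abstract_boolean_algebra\<close>, relativised to the
  carrier. The one-element algebra is not excluded.\<close>

locale normal_modal_algebra =
  fixes A :: "'a modal_algebra"
  assumes closed: "algebra_closed A"
    and meet_assoc: "\<lbrakk>x \<in> carrier A; y \<in> carrier A; z \<in> carrier A\<rbrakk>
          \<Longrightarrow> meet A (meet A x y) z = meet A x (meet A y z)"
    and join_assoc: "\<lbrakk>x \<in> carrier A; y \<in> carrier A; z \<in> carrier A\<rbrakk>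
          \<Longrightarrow> join A (join A x y) z = join A x (join A y z)"
    and meet_commute: "\<lbrakk>x \<in> carrier A; y \<in> carrier A\<rbrakk> \<Longrightarrow> meet A x y = meet A y x"
    and join_commute: "\<lbrakk>x \<in> carrier A; y \<in> carrier A\<rbrakk> \<Longrightarrow> join A x y = join A y x"
    and meet_join_distrib: "\<lbrakk>x \<in> carrier A; y \<in> carrier A; z \<in> carrier A\<rbrakk>
          \<Longrightarrow> meet A x (join A y z) = join A (meet A x y) (meet A x z)"
    and join_meet_distrib: "\<lbrakk>x \<in> carrier A; y \<in> carrier A; z \<in> carrier A\<rbrakk>
          \<Longrightarrow> join A x (meet A y z) = meet A (join A x y) (join A x z)"
    and meet_one: "x \<in> carrier A \<Longrightarrow> meet A x (one A) = x"
    and join_zero: "x \<in> carrier A \<Longrightarrow> join A x (zero A) = x"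
    and meet_cmpl: "x \<in> carrier A \<Longrightarrow> meet A x (cmpl A x) = zero A"
    and join_cmpl: "x \<in> carrier A \<Longrightarrow> join A x (cmpl A x) = one A"
    and box_one: "box A (one A) = one A"
    and box_meet: "\<lbrakk>x \<in> carrier A; y \<in> carrier A\<rbrakk>
          \<Longrightarrow> box A (meet A x y) = meet A (box A x) (box A y)"

primrec eval :: "'a modal_algebra \<Rightarrow> (nat \<Rightarrow> 'a) \<Rightarrow> fm \<Rightarrow> 'a" where
  "eval A \<theta> (Var k) = \<theta> k"
| "eval A \<theta> Top = one A"
| "eval A \<theta> (Neg \<phi>) = cmpl A (eval A \<theta> \<phi>)"
| "eval A \<theta> (And \<phi> \<psi>) = meet A (eval A \<theta> \<phi>) (eval A \<theta> \<psi>)"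
| "eval A \<theta> (Box \<phi>) = box A (eval A \<theta> \<phi>)"

definition valid_in :: "'a modal_algebra \<Rightarrow> fm \<Rightarrow> bool" where
  "valid_in A \<phi> \<longleftrightarrow> (\<forall>\<theta>. range \<theta> \<subseteq> carrier A \<longrightarrow> eval A \<theta> \<phi> = one A)"

definition variety_K4C :: "nat \<Rightarrow> 'a modal_algebra set" where
  "variety_K4C n = {A. normal_modal_algebra A \<and> (\<forall>\<phi> \<in> K4C n. valid_in A \<phi>)}"

section \<open>Class operators\<close>

definition homomorphism :: "'a modal_algebra \<Rightarrow> 'b modal_algebra \<Rightarrow> ('a \<Rightarrow> 'b) \<Rightarrow> bool" where
  "homomorphism A B h \<longleftrightarrow> algebra_closed A \<and> algebra_closed B \<and>
     h \<in> carrier A \<rightarrow> carrier B \<and> h (zero A) = zero B \<and> h (one A) = one B \<and>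
     (\<forall>x\<in>carrier A. h (cmpl A x) = cmpl B (h x) \<and> h (box A x) = box B (h x)) \<and>
     (\<forall>x\<in>carrier A. \<forall>y\<in>carrier A.
        h (meet A x y) = meet B (h x) (h y) \<and> h (join A x y) = join B (h x) (h y))"

definition isomorphic :: "'a modal_algebra \<Rightarrow> 'b modal_algebra \<Rightarrow> bool" where
  "isomorphic A B \<longleftrightarrow> (\<exists>h. homomorphism A B h \<and> bij_betw h (carrier A) (carrier B))"

definition product :: "'i set \<Rightarrow> ('i \<Rightarrow> 'a modal_algebra) \<Rightarrow> ('i \<Rightarrow> 'a) modal_algebra" where
  "product I A = \<lparr>
     carrier = (\<Pi>\<^sub>E i\<in>I. carrier (A i)),
     meet = (\<lambda>x y. \<lambda>i\<in>I. meet (A i) (x i) (y i)),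
     join = (\<lambda>x y. \<lambda>i\<in>I. join (A i) (x i) (y i)),
     cmpl = (\<lambda>x. \<lambda>i\<in>I. cmpl (A i) (x i)),
     zero = (\<lambda>i\<in>I. zero (A i)),
     one = (\<lambda>i\<in>I. one (A i)),
     box = (\<lambda>x. \<lambda>i\<in>I. box (A i) (x i))\<rparr>"

text \<open>Filters on a subset \<open>I\<close> of the type \<open>'i\<close> are identified with the filters on \<open>'i\<close> that
  contain \<open>I\<close>.\<close>

definition ultrafilter_on :: "'i set \<Rightarrow> 'i filter \<Rightarrow> bool" where
  "ultrafilter_on I U \<longleftrightarrow> U \<noteq> bot \<and> eventually (\<lambda>i. i \<in> I) U \<and>
     (\<forall>Q. eventually Q U \<or> eventually (\<lambda>i. \<not> Q i) U)"

definition ultra_rel :: "'i set \<Rightarrow> ('i \<Rightarrow> 'a modal_algebra) \<Rightarrow> 'i filter \<Rightarrow> (('i \<Rightarrow> 'a) \<times> ('i \<Rightarrow> 'a)) set"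
  where "ultra_rel I A U = {(x, y). x \<in> carrier (product I A) \<and> y \<in> carrier (product I A) \<and>
     eventually (\<lambda>i. x i = y i) U}"

text \<open>The operations are those induced on equivalence classes by the product, in the style of
  \<open>UN_equiv_class\<close> and \<open>UN_equiv_class2\<close>.\<close>

definition ultraproduct ::
    "'i set \<Rightarrow> ('i \<Rightarrow> 'a modal_algebra) \<Rightarrow> 'i filter \<Rightarrow> ('i \<Rightarrow> 'a) set modal_algebra" where
  "ultraproduct I A U = (let r = ultra_rel I A U; B = product I A in \<lparr>
     carrier = carrier B // r,
     meet = (\<lambda>X Y. \<Union>x\<in>X. \<Union>y\<in>Y. r `` {meet B x y}),
     join = (\<lambda>X Y. \<Union>x\<in>X. \<Union>y\<in>Y. r `` {join B x y}),
     cmpl = (\<lambda>X. \<Union>x\<in>X. r `` {cmpl B x}),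
     zero = r `` {zero B},
     one = r `` {one B},
     box = (\<lambda>X. \<Union>x\<in>X. r `` {box B x})\<rparr>)"

text \<open>In the operators below the element types of the argument and of the result (and the type
  \<open>'i\<close> from which index sets are taken) are independent type variables, so they have to
  be fixed by type annotations where the operators are composed.\<close>

definition class_H :: "'a modal_algebra set \<Rightarrow> 'b modal_algebra set" ("\<^bold>H") where
  "\<^bold>H K = {B. \<exists>A\<in>K. \<exists>h. homomorphism A B h \<and> h ` carrier A = carrier B}"

definition class_S :: "'a modal_algebra set \<Rightarrow> 'b modal_algebra set" ("\<^bold>S") where
  "\<^bold>S K = {B. \<exists>A\<in>K. \<exists>X. subuniverse X A \<and> isomorphic B (A\<lparr>carrier := X\<rparr>)}"

definition class_P :: "'a modal_algebra set \<Rightarrow> ('i \<Rightarrow> 'a) modal_algebra set" ("\<^bold>P") where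
  "\<^bold>P K = {product I A | I A. \<forall>i\<in>I. A i \<in> K}"

definition class_PU :: "'a modal_algebra set \<Rightarrow> ('i \<Rightarrow> 'a) set modal_algebra set" ("\<^bold>P\<^sub>U") where
  "\<^bold>P\<^sub>U K = {ultraproduct I A U | I A U. (\<forall>i\<in>I. A i \<in> K) \<and> ultrafilter_on I U}"

section \<open>Frames\<close>

definition is_cycle :: "'w set \<Rightarrow> 'w rel \<Rightarrow> 'w list \<Rightarrow> bool" where
  "is_cycle W R xs \<longleftrightarrow> xs \<noteq> [] \<and> distinct xs \<and> set xs \<subseteq> W \<and>
     (\<forall>i < length xs. (xs ! i, xs ! (Suc i mod length xs)) \<in> R)"

definition circumference :: "'w set \<Rightarrow> 'w rel \<Rightarrow> enat" where
  "circumference W R = Sup {enat (length xs) | xs. is_cycle W R xs}"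

text \<open>The empty frame is included; its complex algebra is the one-element algebra.\<close>

definition circum_frames :: "nat \<Rightarrow> ('w set \<times> 'w rel) set" where
  "circum_frames n = {(W, R). finite W \<and> R \<subseteq> W \<times> W \<and> trans R \<and> circumference W R \<le> enat n}"

definition complex_algebra :: "'w set \<times> 'w rel \<Rightarrow> 'w set modal_algebra" where
  "complex_algebra F = (case F of (W, R) \<Rightarrow> \<lparr>
     carrier = Pow W,
     meet = (\<inter>),
     join = (\<union>),
     cmpl = (\<lambda>X. W - X),
     zero = {},
     one = W,
     box = (\<lambda>X. {x \<in> W. \<forall>y. (x, y) \<in> R \<longrightarrow> y \<in> X})\<rparr>)"

definition circum_algebras :: "nat \<Rightarrow> 'w set modal_algebra set" where
  "circum_algebras n = complex_algebra ` circum_frames n"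

text \<open>
  HOL has no quantification over types inside a formula, so membership of an algebra over \<open>'a\<close> in
  \<open>\<^bold>H\<^bold>S\<^bold>P\<close> or \<open>\<^bold>S\<^bold>P\<^sub>U\<close> of the class below needs types for the frames and the index sets. Frames
  over \<^typ>\<open>nat\<close> represent all finite frames up to isomorphism. Index sets in \<^typ>\<open>'a list\<close> are
  large enough: this type is infinite and enumerates the finite subsets of \<open>'a\<close>, and whether an
  algebra embeds into an ultraproduct of members of a class depends only on its finite partial
  subalgebras. Fixing these types makes membership a stronger claim; that nothing is gained by
  other types is the inclusion in the variety for arbitrary types of worlds and indices.\<close>

end

theory Submission
  imports Defs
begin

text \<open>
  The heart of the matter is the finite embeddability property: every finite partial subalgebra of
  an algebra \<open>A\<close> in the variety embeds into the complex algebra of a finite transitive frame of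
  circumference at most \<open>n\<close>. It is obtained by filtrating the frame of ultrafilters of \<open>A\<close> and
  then thinning out the clusters with the help of the axiom \<open>C\<^sub>n\<close>. Choosing such an embedding for
  every finite subset of \<open>A\<close>, indexed by lists, and an ultrafilter that for each \<open>a\<close> contains the
  set of all lists through \<open>a\<close>, one embeds \<open>A\<close> into an ultraproduct. As ultraproducts are
  homomorphic images of products, this also gives membership in \<open>HSP\<close>.
\<close>

subsection \<open>Complex algebras\<close>

text \<open>For mutually exclusive formulas, \<open>fmP\<close> describes a walk that meets \<phi>
  1, ..., \<phi> n in turn and ends in \<phi> 0. In a finite transitive frame, such a walk from a
  suitably chosen point closes up into a cycle of n+1 distinct points; this is where the bound n on
  the circumference enters, and why \<open>fmC n\<close> is sound. Two obstacles shape the converse.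
  First, the axiom is available on the ultrafilter frame only for valuations by sets that represent
  elements of \<open>A\<close>, since nothing is known about arbitrary sets of ultrafilters. It is
  therefore applied only to Boolean combinations of members of \<open>X\<close>. Second, identifying
  worlds can create clusters that are too large. A partial embedding only needs each world to see
  the right types of worlds, so arrows may be deleted as long as no type gets lost. The arrows that
  cannot be replaced by arrows leaving the cluster lead to types that remain reachable for ever, and
  n+1 of these would make \<open>fmP\<close> true for ever, against the axiom.\<close>

lemma complex_algebra_simps [simp]:
  "carrier (complex_algebra (W, R)) = Pow W"
  "meet (complex_algebra (W, R)) = (\<inter>)"
  "join (complex_algebra (W, R)) = (\<union>)"
  "cmpl (complex_algebra (W, R)) = (\<lambda>X. W - X)"
  "zero (complex_algebra (W, R)) = {}"
  "one (complex_algebra (W, R)) = W"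
  "box (complex_algebra (W, R)) = (\<lambda>X. {x \<in> W. \<forall>y. (x, y) \<in> R \<longrightarrow> y \<in> X})"
  by (simp_all add: complex_algebra_def)

lemma normal_complex_algebra:
  "R \<subseteq> W \<times> W \<Longrightarrow> normal_modal_algebra (complex_algebra (W, R))"
  by unfold_locales (auto simp: subuniverse_def)

lemma eval_closed:
  assumes "subuniverse X A" "range \<theta> \<subseteq> X"
  shows "eval A \<theta> \<phi> \<in> X"
  using assms by (induction \<phi>) (auto simp: subuniverse_def)

lemma eval_complex_subset:
  "range \<theta> \<subseteq> Pow W \<Longrightarrow> eval (complex_algebra (W, R)) \<theta> \<phi> \<subseteq> W"
  using eval_closed[of "Pow W" "complex_algebra (W, R)" \<theta> \<phi>] by (auto simp: subuniverse_def)

lemma eval_foldr_And: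
  "x \<in> W \<Longrightarrow> x \<in> eval (complex_algebra (W, R)) \<theta> (foldr And \<phi>s Top) \<longleftrightarrow>
    (\<forall>\<phi> \<in> set \<phi>s. x \<in> eval (complex_algebra (W, R)) \<theta> \<phi>)"
  by (induction \<phi>s) auto

lemma eval_fmD:
  assumes "x \<in> W"
  shows "x \<in> eval (complex_algebra (W, R)) \<theta> (fmD n \<phi>) \<longleftrightarrow>
    (\<forall>j\<le>n. \<forall>i<j. \<not> (x \<in> eval (complex_algebra (W, R)) \<theta> (\<phi> i) \<and>
       x \<in> eval (complex_algebra (W, R)) \<theta> (\<phi> j)))"
  unfolding fmD_def eval_foldr_And[OF assms] using assms
  by (fastforce simp: less_Suc_eq_le simp del: upt_Suc)

lemma eval_fmC:
  fixes W R \<theta> \<phi> n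
  defines "V \<equiv> eval (complex_algebra (W, R)) \<theta>"
  assumes "R \<subseteq> W \<times> W" "x \<in> W"
  shows "x \<in> V (fmC n \<phi>) \<longleftrightarrow>
    (x \<in> V (fmD n \<phi>) \<and> (\<forall>y. (x, y) \<in> R \<longrightarrow> y \<in> V (fmD n \<phi>)) \<longrightarrow>
     (\<exists>y. (x, y) \<in> R \<and> y \<in> V (\<phi> 0)) \<longrightarrow>
     (\<exists>y. (x, y) \<in> R \<and> y \<in> V (\<phi> 0) \<and> y \<notin> V (fmP (\<phi> 0) (map \<phi> [1..<Suc n]))))"
  unfolding V_def fmC_def using assms(2,3) by (auto simp del: upt_Suc)

text \<open>Unwinding the nested diamonds gives a walk from x through points of the \<phi>s to a
  final point z of \<phi>0. The walk condition compares the list \<open>x # zs @ [z]\<close> with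
  its own tail, so index i stands for the i-th arrow.\<close>

lemma eval_fmP_path:
  assumes "R \<subseteq> W \<times> W" "x \<in> W" "x \<in> eval (complex_algebra (W, R)) \<theta> (fmP \<phi>0 \<phi>s)"
  shows "\<exists>zs z. length zs = length \<phi>s \<and>
    (\<forall>i < length \<phi>s. zs ! i \<in> eval (complex_algebra (W, R)) \<theta> (\<phi>s ! i)) \<and>
    z \<in> eval (complex_algebra (W, R)) \<theta> \<phi>0 \<and>
    (\<forall>i < Suc (length zs). ((x # zs @ [z]) ! i, (zs @ [z]) ! i) \<in> R)"
  using assms(2,3)
proof (induction \<phi>s arbitrary: x)
  case Nil
  then show ?case using assms(1) by auto
next
  case (Cons \<phi> \<phi>s)
  then obtain y where y: "(x, y) \<in> R" "y \<in> eval (complex_algebra (W, R)) \<theta> \<phi>"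
    "y \<in> eval (complex_algebra (W, R)) \<theta> (fmP \<phi>0 \<phi>s)" "y \<in> W"
    using assms(1) by auto
  from Cons.IH[OF y(4,3)] obtain zs z where *: "length zs = length \<phi>s"
    "\<forall>i < length \<phi>s. zs ! i \<in> eval (complex_algebra (W, R)) \<theta> (\<phi>s ! i)"
    "z \<in> eval (complex_algebra (W, R)) \<theta> \<phi>0"
    "\<forall>i < Suc (length zs). ((y # zs @ [z]) ! i, (zs @ [z]) ! i) \<in> R"
    by blast
  have "((x # (y # zs) @ [z]) ! i, ((y # zs) @ [z]) ! i) \<in> R" if "i < Suc (length (y # zs))" for i
    using that y(1) *(4) by (cases i) auto
  moreover have "\<forall>i < length (\<phi> # \<phi>s). (y # zs) ! i \<in> eval (complex_algebra (W, R)) \<theta> ((\<phi> # \<phi>s) ! i)"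
    using *(2) y(2) by (auto simp: nth_Cons split: nat.splits)
  ultimately show ?case using *(1,3) by (intro exI[of _ "y # zs"] exI[of _ z]) auto
qed

text \<open>If every formula can be reached in one step without leaving Q, then the walk demanded by
  \<open>fmP\<close> can be continued for ever inside Q, whatever the order of the formulas.\<close>

lemma eval_fmP_coinduct:
  assumes "R \<subseteq> W \<times> W" "Q \<subseteq> W"
    "\<And>x \<phi>. x \<in> Q \<Longrightarrow> \<phi> \<in> set (\<phi>0 # \<phi>s) \<Longrightarrow>
      \<exists>y \<in> Q. (x, y) \<in> R \<and> y \<in> eval (complex_algebra (W, R)) \<theta> \<phi>"
  shows "Q \<subseteq> eval (complex_algebra (W, R)) \<theta> (fmP \<phi>0 \<phi>s)"
  using assms(3)
proof (induction \<phi>s)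
  case Nil
  then show ?case using assms(1,2) by fastforce
next
  case (Cons \<phi> \<phi>s)
  have IH: "Q \<subseteq> eval (complex_algebra (W, R)) \<theta> (fmP \<phi>0 \<phi>s)"
    by (rule Cons.IH) (use Cons.prems in auto)
  show ?case
  proof
    fix x assume x: "x \<in> Q"
    obtain y where "y \<in> Q" "(x, y) \<in> R" "y \<in> eval (complex_algebra (W, R)) \<theta> \<phi>"
      using Cons.prems[OF x, of \<phi>] by auto
    then show "x \<in> eval (complex_algebra (W, R)) \<theta> (fmP \<phi>0 (\<phi> # \<phi>s))"
      using IH assms(1,2) x by auto
  qed
qed

section \<open>Cycles and circumference in transitive frames\<close>

lemma cycle_related:
  assumes "trans R" "is_cycle W R xs" "x \<in> set xs" "y \<in> set xs"
  shows "(x, y) \<in> R"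
proof -
  let ?l = "length xs"
  have step: "(xs ! i, xs ! (Suc i mod ?l)) \<in> R" if "i < ?l" for i
    using assms(2) that by (simp add: is_cycle_def)
  have pos: "0 < ?l" using assms(3) by (cases xs) auto
  obtain i j where ij: "i < ?l" "x = xs ! i" "j < ?l" "y = xs ! j"
    using assms(3,4) by (metis in_set_conv_nth)
  have "(xs ! i, xs ! (Suc (i + k) mod ?l)) \<in> R" for k
  proof (induction k)
    case 0
    then show ?case using step[OF ij(1)] by simp
  next
    case (Suc k)
    have "(xs ! (Suc (i + k) mod ?l), xs ! (Suc (i + Suc k) mod ?l)) \<in> R"
      using step[of "Suc (i + k) mod ?l"] pos by (simp add: mod_Suc_eq)
    with Suc show ?case using \<open>trans R\<close> by (meson transD)
  qed
  \<comment> \<open>Walking on from i to the end of the list and then j further reaches j modulo the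
    length. At least one arrow is used, so the case x = y is included and the points of a cycle are
    reflexive.\<close>
  moreover have "Suc (i + (?l - Suc i + j)) = ?l + j" using ij by linarith
  moreover have "(?l + j) mod ?l = j" using ij by simp
  ultimately show ?thesis using ij by metis
qed

lemma circum_framesI:
  assumes "finite W" "R \<subseteq> W \<times> W" "trans R" "\<And>xs. is_cycle W R xs \<Longrightarrow> length xs \<le> n"
  shows "(W, R) \<in> circum_frames n"
  using assms by (auto simp: circum_frames_def circumference_def intro!: Sup_least)

lemma circum_frames_cycle:
  assumes "(W, R) \<in> circum_frames n" "is_cycle W R xs"
  shows "length xs \<le> n"
proof -
  have "enat (length xs) \<le> circumference W R"
    unfolding circumference_def using assms(2) by (intro Sup_upper) auto
  also have "\<dots> \<le> enat n" using assms(1) by (simp add: circum_frames_def)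
  finally show ?thesis by simp
qed

text \<open>Serves to renumber the worlds of a finite frame; cycles are pulled back along the
  inverse of f.\<close>

lemma circum_frames_image:
  assumes F: "(W, R) \<in> circum_frames n" and f: "inj_on f W"
  shows "(f ` W, map_prod f f ` R) \<in> circum_frames n"
proof (rule circum_framesI)
  have R: "R \<subseteq> W \<times> W" "trans R" "finite W" using F by (auto simp: circum_frames_def)
  let ?g = "inv_into W f"
  have g: "(?g u, ?g v) \<in> R" if "(u, v) \<in> map_prod f f ` R" for u v
    using that R(1) f by (auto simp: subset_iff)
  show "finite (f ` W)" "map_prod f f ` R \<subseteq> f ` W \<times> f ` W" using R by auto
  show "trans (map_prod f f ` R)"
  proof (rule transI)
    fix u v w assume "(u, v) \<in> map_prod f f ` R" "(v, w) \<in> map_prod f f ` R"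
    then obtain a b b' c where "(a, b) \<in> R" "(b', c) \<in> R" "u = f a" "v = f b" "v = f b'" "w = f c"
      by auto
    moreover then have "b = b'" using R(1) f by (auto dest: inj_onD)
    ultimately show "(u, w) \<in> map_prod f f ` R" using \<open>trans R\<close> by (auto dest: transD)
  qed
  fix xs assume xs: "is_cycle (f ` W) (map_prod f f ` R) xs"
  have "is_cycle W R (map ?g xs)"
    unfolding is_cycle_def
  proof (intro conjI allI impI)
    show "map ?g xs \<noteq> []" using xs by (auto simp: is_cycle_def)
    have "inj_on ?g (f ` W)" by (simp add: inj_on_inv_into)
    then show "distinct (map ?g xs)"
      using xs by (auto simp: is_cycle_def distinct_map intro: inj_on_subset)
    show "set (map ?g xs) \<subseteq> W" using xs by (auto simp: is_cycle_def inv_into_into)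
    fix i assume i: "i < length (map ?g xs)"
    moreover from this have "Suc i mod length xs < length xs" by (cases xs) auto
    ultimately show "(map ?g xs ! i, map ?g xs ! (Suc i mod length (map ?g xs))) \<in> R"
      using xs by (auto simp: is_cycle_def intro!: g)
  qed
  from circum_frames_cycle[OF F this] show "length xs \<le> n" by simp
qed

text \<open>A point of \<open>\<phi> 0\<close> whose set of successors is minimal lies on any cycle that it starts.\<close>

lemma valid_fmC:
  assumes F: "(W, R) \<in> circum_frames n"
  shows "valid_in (complex_algebra (W, R)) (fmC n \<phi>)"
  unfolding valid_in_def
proof (intro allI impI)
  fix \<theta> :: "nat \<Rightarrow> 'a set" assume \<theta>: "range \<theta> \<subseteq> carrier (complex_algebra (W, R))"
  let ?V = "eval (complex_algebra (W, R)) \<theta>"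
  have R: "R \<subseteq> W \<times> W" "trans R" "finite W" using F by (auto simp: circum_frames_def)
  have fin: "finite (R `` {y})" for y using R by (auto intro: finite_subset[of _ W])
  have "x \<in> ?V (fmC n \<phi>)" if x: "x \<in> W" for x
    unfolding eval_fmC[OF R(1) x]
  proof (intro impI)
    assume D: "x \<in> ?V (fmD n \<phi>) \<and> (\<forall>y. (x, y) \<in> R \<longrightarrow> y \<in> ?V (fmD n \<phi>))"
    assume "\<exists>y. (x, y) \<in> R \<and> y \<in> ?V (\<phi> 0)"
    then obtain y where y: "(x, y) \<in> R" "y \<in> ?V (\<phi> 0)"
      and min: "\<And>z. (x, z) \<in> R \<Longrightarrow> z \<in> ?V (\<phi> 0) \<Longrightarrow> card (R `` {y}) \<le> card (R `` {z})"
      using ex_has_least_nat[of "\<lambda>y. (x, y) \<in> R \<and> y \<in> ?V (\<phi> 0)" _ "\<lambda>y. card (R `` {y})"]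
      by blast
    have "y \<notin> ?V (fmP (\<phi> 0) (map \<phi> [1..<Suc n]))"
    proof
      assume "y \<in> ?V (fmP (\<phi> 0) (map \<phi> [1..<Suc n]))"
      moreover have "y \<in> W" using y R by auto
      ultimately obtain zs z where zs: "length zs = n"
        "\<And>i. i < n \<Longrightarrow> zs ! i \<in> ?V (\<phi> (Suc i))" and z: "z \<in> ?V (\<phi> 0)"
        and path: "\<And>i. i < Suc n \<Longrightarrow> ((y # zs @ [z]) ! i, (zs @ [z]) ! i) \<in> R"
        using eval_fmP_path[OF R(1), of y \<theta> "\<phi> 0" "map \<phi> [1..<Suc n]"]
        by (auto simp del: upt_Suc)
      have yzs: "(y, (zs @ [z]) ! i) \<in> R" if "i < Suc n" for i
        using that
      proof (induction i)
        case 0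
        then show ?case using path[of 0] by simp
      next
        case (Suc i)
        then have "(y, (zs @ [z]) ! i) \<in> R" by simp
        moreover have "((zs @ [z]) ! i, (zs @ [z]) ! Suc i) \<in> R" using path[OF Suc.prems] by simp
        ultimately show ?case using R(2) by (meson transD)
      qed
      from yzs[of n] zs have yz: "(y, z) \<in> R" by (simp add: nth_append)
      then have sub: "R `` {z} \<subseteq> R `` {y}" using R(2) by (auto dest: transD)
      have "(x, z) \<in> R" using y yz R(2) by (meson transD)
      \<comment> \<open>By transitivity z sees no more than y, and by the choice of y no less. Hence
        z sees the first point of the walk, and also itself, so the walk closes into the cycle
        \<open>z # zs\<close>. The point y is left out: it satisfies \<open>\<phi> 0\<close> as z
        does and may be equal to z.\<close>
      from min[OF this z] have eq: "R `` {z} = R `` {y}"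
        using sub fin by (intro card_subset_eq) (auto intro: antisym card_mono)
      have inW: "(x, (z # zs) ! i) \<in> R" if "i \<le> n" for i
      proof (cases i)
        case 0
        then show ?thesis using \<open>(x, z) \<in> R\<close> by simp
      next
        case (Suc j)
        then show ?thesis using that yzs[of j] y zs(1) R(2)
          by (auto simp: nth_append dest: transD)
      qed
      have val: "(z # zs) ! i \<in> ?V (\<phi> i)" if "i \<le> n" for i
        using that zs z by (cases i) auto
      \<comment> \<open>The n+1 entries satisfy \<open>\<phi> 0\<close>, ...,
        \<open>\<phi> n\<close> in this order, and all are successors of x, where \<open>fmD\<close>
        makes these formulas exclude each other. So the cycle is one point longer than the
        circumference allows.\<close>
      have "(z # zs) ! i \<noteq> (z # zs) ! j" if "i < j" "j \<le> n" for i j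
      proof
        assume eq: "(z # zs) ! i = (z # zs) ! j"
        have "(z # zs) ! j \<in> W" "(z # zs) ! j \<in> ?V (fmD n \<phi>)" using inW[OF that(2)] R D by auto
        then show False using that val[of i] val[of j] eq by (auto simp: eval_fmD)
      qed
      then have dist: "distinct (z # zs)"
        unfolding distinct_conv_nth using zs(1) by (metis length_Cons less_Suc_eq_le nat_neq_iff)
      have "is_cycle W R (z # zs)"
        unfolding is_cycle_def
      proof (intro conjI allI impI)
        show "set (z # zs) \<subseteq> W"
        proof
          fix u assume "u \<in> set (z # zs)"
          then obtain i where "i \<le> n" "u = (z # zs) ! i"
            using zs(1) by (metis in_set_conv_nth length_Cons less_Suc_eq_le)
          then show "u \<in> W" using inW R(1) by auto
        qed
        fix i assume "i < length (z # zs)"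
        then have i: "i < Suc n" using zs by simp
        show "((z # zs) ! i, (z # zs) ! (Suc i mod length (z # zs))) \<in> R"
        proof (cases "i = 0")
          case True
          have "(z, (zs @ [z]) ! 0) \<in> R" using yzs[of 0] eq by auto
          then show ?thesis using True zs(1) by (cases zs) auto
        next
          case False
          then show ?thesis using path[OF i] i zs(1)
            by (cases "i = n") (auto simp: nth_append nth_Cons' split: if_splits)
        qed
      qed (use dist in auto)
      from circum_frames_cycle[OF F this] show False using zs(1) by simp
    qed
    with y show "\<exists>y. (x, y) \<in> R \<and> y \<in> ?V (\<phi> 0) \<and> y \<notin> ?V (fmP (\<phi> 0) (map \<phi> [1..<Suc n]))"
      by blast
  qed
  moreover have "?V (fmC n \<phi>) \<subseteq> W" using \<theta> by (intro eval_complex_subset) simp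
  ultimately show "?V (fmC n \<phi>) = one (complex_algebra (W, R))" by auto
qed

section \<open>The logic of a complex algebra\<close>

lemma eval_subst: "eval A \<theta> (subst \<sigma> \<phi>) = eval A (\<lambda>k. eval A \<theta> (\<sigma> k)) \<phi>"
  by (induction \<phi>) auto

text \<open>A world determines a propositional valuation in which boxed formulas count as atoms;
  this is what makes tautologies true at each world.\<close>

lemma eval_prop_eval:
  "x \<in> W \<Longrightarrow> x \<in> eval (complex_algebra (W, R)) \<theta> \<phi> \<longleftrightarrow>
    prop_eval (\<lambda>\<psi>. x \<in> eval (complex_algebra (W, R)) \<theta> \<psi>) \<phi>"
  by (induction \<phi>) auto

lemma valid_complexI:
  assumes "\<And>\<theta> x. range \<theta> \<subseteq> Pow W \<Longrightarrow> x \<in> W \<Longrightarrow> x \<in> eval (complex_algebra (W, R)) \<theta> \<phi>"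
  shows "valid_in (complex_algebra (W, R)) \<phi>"
  unfolding valid_in_def
proof (intro allI impI)
  fix \<theta> :: "nat \<Rightarrow> 'a set" assume "range \<theta> \<subseteq> carrier (complex_algebra (W, R))"
  then have \<theta>: "range \<theta> \<subseteq> Pow W" by simp
  show "eval (complex_algebra (W, R)) \<theta> \<phi> = one (complex_algebra (W, R))"
    using assms[OF \<theta>] eval_complex_subset[OF \<theta>] by auto
qed

lemma valid_complexD:
  assumes "valid_in (complex_algebra (W, R)) \<phi>" "range \<theta> \<subseteq> Pow W"
  shows "eval (complex_algebra (W, R)) \<theta> \<phi> = W"
  using assms by (simp add: valid_in_def)

lemma normal_logic_complex:
  assumes R: "R \<subseteq> W \<times> W"
  shows "normal_logic {\<phi>. valid_in (complex_algebra (W, R)) \<phi>}"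
  unfolding normal_logic_def
proof (intro conjI allI impI; simp only: mem_Collect_eq)
  let ?A = "complex_algebra (W, R)"
  fix \<phi> \<psi> \<sigma>
  show "tautology \<phi> \<Longrightarrow> valid_in ?A \<phi>"
    by (rule valid_complexI) (metis tautology_def eval_prop_eval)
  show "valid_in ?A (Imp (Box (Imp \<phi> \<psi>)) (Imp (Box \<phi>) (Box \<psi>)))"
    by (rule valid_complexI) auto
  show "valid_in ?A \<psi>" if "valid_in ?A \<phi>" "valid_in ?A (Imp \<phi> \<psi>)"
  proof (rule valid_complexI)
    fix \<theta> :: "nat \<Rightarrow> 'a set" and x assume "range \<theta> \<subseteq> Pow W" "x \<in> W"
    then have "x \<in> eval ?A \<theta> \<phi>" "x \<in> eval ?A \<theta> (Imp \<phi> \<psi>)"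
      using that[THEN valid_complexD] by blast+
    then show "x \<in> eval ?A \<theta> \<psi>" by auto
  qed
  show "valid_in ?A \<phi> \<Longrightarrow> valid_in ?A (Box \<phi>)"
    using normal_modal_algebra.box_one[OF normal_complex_algebra[OF R]]
    by (simp add: valid_in_def)
  show "valid_in ?A (subst \<sigma> \<phi>)" if "valid_in ?A \<phi>"
    unfolding valid_in_def eval_subst
  proof (intro allI impI)
    fix \<theta> :: "nat \<Rightarrow> 'a set" assume "range \<theta> \<subseteq> carrier ?A"
    then have "range (\<lambda>k. eval ?A \<theta> (\<sigma> k)) \<subseteq> carrier ?A"
      using eval_complex_subset[of \<theta> W R] by auto
    with that show "eval ?A (\<lambda>k. eval ?A \<theta> (\<sigma> k)) \<phi> = one ?A"
      unfolding valid_in_def by blast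
  qed
qed

text \<open>As \<open>K4C n\<close> is an intersection of logics, soundness is one inclusion instead
  of an induction over derivations: the formulas valid in the algebra form one of the logics
  intersected.\<close>

lemma complex_algebra_in_variety:
  assumes F: "F \<in> circum_frames n"
  shows "complex_algebra F \<in> variety_K4C n"
proof -
  obtain W R where F': "F = (W, R)" "(W, R) \<in> circum_frames n" using F by (cases F) auto
  have "R \<subseteq> W \<times> W" "trans R" using F' by (simp_all add: circum_frames_def)
  from \<open>R \<subseteq> W \<times> W\<close> \<open>trans R\<close> have "valid_in (complex_algebra F) (Imp (Box \<phi>) (Box (Box \<phi>)))" for \<phi>
    unfolding F' by (intro valid_complexI) (auto dest: transD)
  then have "{\<phi>. valid_in (complex_algebra F) \<phi>} \<in> {L. normal_logic L \<and>
      (\<forall>\<phi>. Imp (Box \<phi>) (Box (Box \<phi>)) \<in> L) \<and> (\<forall>\<phi>. fmC n \<phi> \<in> L)}"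
    using valid_fmC[OF F'(2)] normal_logic_complex[OF \<open>R \<subseteq> W \<times> W\<close>] F'(1) by simp
  then have "K4C n \<subseteq> {\<phi>. valid_in (complex_algebra F) \<phi>}"
    unfolding K4C_def by (rule Inter_lower)
  then show ?thesis using normal_complex_algebra[OF \<open>R \<subseteq> W \<times> W\<close>] F'(1) by (auto simp: variety_K4C_def)
qed


subsection \<open>Homomorphisms, products and ultraproducts\<close>

lemma homomorphism_eval:
  assumes "homomorphism A B h" "range \<theta> \<subseteq> carrier A"
  shows "h (eval A \<theta> \<phi>) = eval B (h \<circ> \<theta>) \<phi>"
proof -
  have cl: "eval A \<theta> \<psi> \<in> carrier A" for \<psi>
    using assms by (intro eval_closed) (auto simp: homomorphism_def)
  show ?thesis
    using assms(1) cl by (induction \<phi>) (simp_all add: homomorphism_def)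
qed

lemma homomorphism_comp:
  assumes "homomorphism A B f" "homomorphism B C g"
  shows "homomorphism A C (g \<circ> f)"
  using assms unfolding homomorphism_def by (auto simp: Pi_iff)

lemma homomorphism_inclusion:
  assumes "subuniverse X A" "algebra_closed A"
  shows "homomorphism (A\<lparr>carrier := X\<rparr>) A id"
  using assms unfolding homomorphism_def subuniverse_def by auto

lemma homomorphism_image_subuniverse:
  assumes "homomorphism A B h"
  shows "subuniverse (h ` carrier A) B"
  using assms unfolding homomorphism_def subuniverse_def
  by (auto simp: Pi_iff image_iff) metis+

lemma homomorphism_subalgebra:
  assumes "homomorphism A B h" "subuniverse X B" "h ` carrier A \<subseteq> X"
  shows "homomorphism A (B\<lparr>carrier := X\<rparr>) h"
  using assms unfolding homomorphism_def subuniverse_def by auto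

lemma embedding_isomorphic:
  assumes "homomorphism A B h" "inj_on h (carrier A)"
  shows "isomorphic A (B\<lparr>carrier := h ` carrier A\<rparr>)"
  unfolding isomorphic_def
  using homomorphism_subalgebra[OF assms(1) homomorphism_image_subuniverse[OF assms(1)]] assms(2)
  by (intro exI[of _ h]) (auto simp: bij_betw_def)

lemma algebra_closed_normal: "A \<in> variety_K4C n \<Longrightarrow> algebra_closed A"
  by (simp add: variety_K4C_def normal_modal_algebra.closed)

section \<open>Preservation of the variety by homomorphic images and embeddings\<close>

lemma variety_homomorphic_image:
  fixes A :: "'a modal_algebra" and B :: "'b modal_algebra"
  assumes A: "A \<in> variety_K4C n" and h: "homomorphism A B h" and surj: "h ` carrier A = carrier B"
  shows "B \<in> variety_K4C n"
proof -
  interpret A: normal_modal_algebra A using A by (simp add: variety_K4C_def)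
  note cl = A.closed[unfolded subuniverse_def]
  note hs = h[unfolded homomorphism_def]
  have ex: "\<exists>x \<in> carrier A. h x = y" if "y \<in> carrier B" for y
    using that surj by (metis imageE)
  have hb: "zero B = h (zero A)" "one B = h (one A)"
    "\<And>x. x \<in> carrier A \<Longrightarrow> cmpl B (h x) = h (cmpl A x)"
    "\<And>x. x \<in> carrier A \<Longrightarrow> box B (h x) = h (box A x)"
    "\<And>x y. x \<in> carrier A \<Longrightarrow> y \<in> carrier A \<Longrightarrow> meet B (h x) (h y) = h (meet A x y)"
    "\<And>x y. x \<in> carrier A \<Longrightarrow> y \<in> carrier A \<Longrightarrow> join B (h x) (h y) = h (join A x y)"
    using hs by simp_all
  have "normal_modal_algebra B"
  proof (unfold_locales, goal_cases)
    case 1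
    then show ?case using h by (simp add: homomorphism_def)
  next
    case (2 x y z)
    then obtain x' y' z' where "x' \<in> carrier A" "x = h x'" "y' \<in> carrier A" "y = h y'" "z' \<in> carrier A" "z = h z'"
      by (metis ex)
    then show ?case using A.meet_assoc[of x' y' z'] cl by (simp add: hb)
  next
    case (3 x y z)
    then obtain x' y' z' where "x' \<in> carrier A" "x = h x'" "y' \<in> carrier A" "y = h y'" "z' \<in> carrier A" "z = h z'"
      by (metis ex)
    then show ?case using A.join_assoc[of x' y' z'] cl by (simp add: hb)
  next
    case (4 x y)
    then obtain x' y' where "x' \<in> carrier A" "x = h x'" "y' \<in> carrier A" "y = h y'"
      by (metis ex)
    then show ?case using A.meet_commute[of x' y'] cl by (simp add: hb)
  next
    case (5 x y)
    then obtain x' y' where "x' \<in> carrier A" "x = h x'" "y' \<in> carrier A" "y = h y'"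
      by (metis ex)
    then show ?case using A.join_commute[of x' y'] cl by (simp add: hb)
  next
    case (6 x y z)
    then obtain x' y' z' where "x' \<in> carrier A" "x = h x'" "y' \<in> carrier A" "y = h y'" "z' \<in> carrier A" "z = h z'"
      by (metis ex)
    then show ?case using A.meet_join_distrib[of x' y' z'] cl by (simp add: hb)
  next
    case (7 x y z)
    then obtain x' y' z' where "x' \<in> carrier A" "x = h x'" "y' \<in> carrier A" "y = h y'" "z' \<in> carrier A" "z = h z'"
      by (metis ex)
    then show ?case using A.join_meet_distrib[of x' y' z'] cl by (simp add: hb)
  next
    case (8 x)
    then obtain x' where "x' \<in> carrier A" "x = h x'"
      by (metis ex)
    then show ?case using A.meet_one[of x'] cl by (simp add: hb)
  next
    case (9 x)
    then obtain x' where "x' \<in> carrier A" "x = h x'"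
      by (metis ex)
    then show ?case using A.join_zero[of x'] cl by (simp add: hb)
  next
    case (10 x)
    then obtain x' where "x' \<in> carrier A" "x = h x'"
      by (metis ex)
    then show ?case using A.meet_cmpl[of x'] cl by (simp add: hb)
  next
    case (11 x)
    then obtain x' where "x' \<in> carrier A" "x = h x'"
      by (metis ex)
    then show ?case using A.join_cmpl[of x'] cl by (simp add: hb)
  next
    case 12
    then show ?case using cl A.box_one by (simp add: hb)
  next
    case (13 x y)
    then obtain x' y' where "x' \<in> carrier A" "x = h x'" "y' \<in> carrier A" "y = h y'"
      by (metis ex)
    then show ?case using A.box_meet[of x' y'] cl by (simp add: hb)
  qed
  moreover have "valid_in B \<phi>" if "\<phi> \<in> K4C n" for \<phi>
    unfolding valid_in_def
  proof (intro allI impI)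
    fix \<theta> :: "nat \<Rightarrow> 'b" assume "range \<theta> \<subseteq> carrier B"
    then have "\<forall>k. \<exists>x \<in> carrier A. h x = \<theta> k" using ex by blast
    \<comment> \<open>Validity is tested in \<open>B\<close> on valuations, and by surjectivity each
      of them lifts to a valuation in \<open>A\<close>.\<close>
    then obtain \<eta> where \<eta>: "\<And>k. \<eta> k \<in> carrier A" "\<And>k. h (\<eta> k) = \<theta> k" by metis
    then have "range \<eta> \<subseteq> carrier A" "\<theta> = h \<circ> \<eta>" by auto
    then show "eval B \<theta> \<phi> = one B"
      using A that homomorphism_eval[OF h, of \<eta> \<phi>] hs by (simp add: variety_K4C_def valid_in_def)
  qed
  ultimately show ?thesis by (simp add: variety_K4C_def)
qed

lemma variety_embedding:
  fixes A :: "'a modal_algebra" and B :: "'b modal_algebra"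
  assumes B: "B \<in> variety_K4C n" and h: "homomorphism A B h" and inj: "inj_on h (carrier A)"
  shows "A \<in> variety_K4C n"
proof -
  interpret B: normal_modal_algebra B using B by (simp add: variety_K4C_def)
  note hs = h[unfolded homomorphism_def]
  have cl: "algebra_closed A" using hs by simp
  note cl' = cl[unfolded subuniverse_def]
  have hc: "h x \<in> carrier B" if "x \<in> carrier A" for x using that hs by auto
  have eq: "x = y" if "h x = h y" "x \<in> carrier A" "y \<in> carrier A" for x y
    using that inj by (auto dest: inj_onD)
  have "normal_modal_algebra A"
  proof (unfold_locales, goal_cases)
    case 1
    then show ?case by (rule cl)
  next
    case (2 x y z)
    then show ?case using cl' hs hc B.meet_assoc by (intro eq) simp_all
  next
    case (3 x y z)
    then show ?case using cl' hs hc B.join_assoc by (intro eq) simp_all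
  next
    case (4 x y)
    then show ?case using cl' hs hc B.meet_commute by (intro eq) simp_all
  next
    case (5 x y)
    then show ?case using cl' hs hc B.join_commute by (intro eq) simp_all
  next
    case (6 x y z)
    then show ?case using cl' hs hc B.meet_join_distrib by (intro eq) simp_all
  next
    case (7 x y z)
    then show ?case using cl' hs hc B.join_meet_distrib by (intro eq) simp_all
  next
    case (8 x)
    then show ?case using cl' hs hc B.meet_one by (intro eq) simp_all
  next
    case (9 x)
    then show ?case using cl' hs hc B.join_zero by (intro eq) simp_all
  next
    case (10 x)
    then show ?case using cl' hs hc B.meet_cmpl by (intro eq) simp_all
  next
    case (11 x)
    then show ?case using cl' hs hc B.join_cmpl by (intro eq) simp_all
  next
    case 12
    then show ?case using cl' hs hc B.box_one by (intro eq) simp_all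
  next
    case (13 x y)
    then show ?case using cl' hs hc B.box_meet by (intro eq) simp_all
  qed
  moreover have "valid_in A \<phi>" if "\<phi> \<in> K4C n" for \<phi>
    unfolding valid_in_def
  proof (intro allI impI)
    fix \<theta> :: "nat \<Rightarrow> 'a" assume \<theta>: "range \<theta> \<subseteq> carrier A"
    then have "range (h \<circ> \<theta>) \<subseteq> carrier B" using hc by auto
    then have "h (eval A \<theta> \<phi>) = h (one A)"
      using B that homomorphism_eval[OF h \<theta>, of \<phi>] hs
      by (simp add: variety_K4C_def valid_in_def)
    then show "eval A \<theta> \<phi> = one A"
      using eval_closed[OF cl \<theta>] cl' by (intro eq) simp_all
  qed
  ultimately show ?thesis by (simp add: variety_K4C_def)
qed

section \<open>Products and ultraproducts\<close>

lemma product_simps [simp]: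
  "carrier (product I A) = (\<Pi>\<^sub>E i\<in>I. carrier (A i))"
  "meet (product I A) x y = (\<lambda>i\<in>I. meet (A i) (x i) (y i))"
  "join (product I A) x y = (\<lambda>i\<in>I. join (A i) (x i) (y i))"
  "cmpl (product I A) x = (\<lambda>i\<in>I. cmpl (A i) (x i))"
  "zero (product I A) = (\<lambda>i\<in>I. zero (A i))"
  "one (product I A) = (\<lambda>i\<in>I. one (A i))"
  "box (product I A) x = (\<lambda>i\<in>I. box (A i) (x i))"
  by (simp_all add: product_def)

lemma algebra_closed_product:
  assumes "\<And>i. i \<in> I \<Longrightarrow> algebra_closed (A i)"
  shows "algebra_closed (product I A)"
  using assms unfolding subuniverse_def by (auto simp: PiE_iff)

lemma homomorphism_projection:
  assumes "\<And>i. i \<in> I \<Longrightarrow> algebra_closed (A i)" "i \<in> I"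
  shows "homomorphism (product I A) (A i) (\<lambda>x. x i)"
  using assms algebra_closed_product[of I A] unfolding homomorphism_def by auto

lemma variety_product:
  fixes A :: "'i \<Rightarrow> 'a modal_algebra"
  assumes A: "\<And>i. i \<in> I \<Longrightarrow> A i \<in> variety_K4C n"
  shows "product I A \<in> variety_K4C n"
proof -
  have nma: "normal_modal_algebra (A i)" if "i \<in> I" for i
    using A[OF that] by (simp add: variety_K4C_def)
  note cl = normal_modal_algebra.closed[OF nma]
  have cl_prod: "algebra_closed (product I A)"
    by (rule algebra_closed_product) (rule cl)
  have "normal_modal_algebra (product I A)"
  proof (unfold_locales, goal_cases)
    case 1
    then show ?case by (rule cl_prod)
  next
    case (2 x y z)
    then show ?case using normal_modal_algebra.meet_assoc[OF nma] by (auto simp: PiE_iff restrict_def fun_eq_iff)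
  next
    case (3 x y z)
    then show ?case using normal_modal_algebra.join_assoc[OF nma] by (auto simp: PiE_iff restrict_def fun_eq_iff)
  next
    case (4 x y)
    then show ?case using normal_modal_algebra.meet_commute[OF nma] by (auto simp: PiE_iff restrict_def fun_eq_iff)
  next
    case (5 x y)
    then show ?case using normal_modal_algebra.join_commute[OF nma] by (auto simp: PiE_iff restrict_def fun_eq_iff)
  next
    case (6 x y z)
    then show ?case using normal_modal_algebra.meet_join_distrib[OF nma] by (auto simp: PiE_iff restrict_def fun_eq_iff)
  next
    case (7 x y z)
    then show ?case using normal_modal_algebra.join_meet_distrib[OF nma] by (auto simp: PiE_iff restrict_def fun_eq_iff)
  next
    case (8 x)
    then show ?case using normal_modal_algebra.meet_one[OF nma]
      by (auto simp: PiE_iff restrict_def fun_eq_iff extensional_def)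
  next
    case (9 x)
    then show ?case using normal_modal_algebra.join_zero[OF nma]
      by (auto simp: PiE_iff restrict_def fun_eq_iff extensional_def)
  next
    case (10 x)
    then show ?case using normal_modal_algebra.meet_cmpl[OF nma] by (auto simp: PiE_iff restrict_def fun_eq_iff)
  next
    case (11 x)
    then show ?case using normal_modal_algebra.join_cmpl[OF nma] by (auto simp: PiE_iff restrict_def fun_eq_iff)
  next
    case 12
    then show ?case using normal_modal_algebra.box_one[OF nma] by (auto simp: restrict_def fun_eq_iff)
  next
    case (13 x y)
    then show ?case using normal_modal_algebra.box_meet[OF nma] by (auto simp: PiE_iff restrict_def fun_eq_iff)
  qed
  moreover have "valid_in (product I A) \<phi>" if \<phi>: "\<phi> \<in> K4C n" for \<phi>
    unfolding valid_in_def
  proof (intro allI impI)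
    fix \<theta> :: "nat \<Rightarrow> 'i \<Rightarrow> 'a" assume \<theta>: "range \<theta> \<subseteq> carrier (product I A)"
    have "eval (product I A) \<theta> \<phi> i = one (A i)" if i: "i \<in> I" for i
    proof -
      have "range ((\<lambda>x. x i) \<circ> \<theta>) \<subseteq> carrier (A i)" using \<theta> i by (auto simp: PiE_iff)
      then show ?thesis
        using A[OF i] \<phi> homomorphism_eval[OF homomorphism_projection[OF cl i] \<theta>, of \<phi>]
        by (simp add: variety_K4C_def valid_in_def)
    qed
    moreover have "eval (product I A) \<theta> \<phi> \<in> carrier (product I A)"
      using cl_prod \<theta> by (rule eval_closed)
    \<comment> \<open>Elements of a product are extensional functions with a fixed value outside
      \<open>I\<close>, so agreement at the indices in \<open>I\<close> suffices.\<close>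
    ultimately show "eval (product I A) \<theta> \<phi> = one (product I A)"
      by (auto simp: PiE_iff restrict_def fun_eq_iff extensional_def)
  qed
  ultimately show ?thesis by (simp add: variety_K4C_def)
qed

lemma equiv_ultra_rel: "equiv (carrier (product I A)) (ultra_rel I A U)"
proof (rule equivI)
  show "trans (ultra_rel I A U)"
    by (auto simp: trans_def ultra_rel_def elim: eventually_elim2)
qed (auto simp: ultra_rel_def refl_on_def sym_def eq_commute)

text \<open>The operations are unions over all representatives. If arguments agree on sets of the
  filter, then so do the pointwise results, on the intersection of these sets; the union therefore
  collapses to the class of any single representative.\<close>

lemma ultraproduct_simps [simp]:
  fixes I A U
  defines "q \<equiv> \<lambda>x. ultra_rel I A U `` {x}"
  assumes closed: "\<And>i. i \<in> I \<Longrightarrow> algebra_closed (A i)" and "ultrafilter_on I U"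
  shows "carrier (ultraproduct I A U) = q ` carrier (product I A)"
    "zero (ultraproduct I A U) = q (zero (product I A))"
    "one (ultraproduct I A U) = q (one (product I A))"
    "x \<in> carrier (product I A) \<Longrightarrow> cmpl (ultraproduct I A U) (q x) = q (cmpl (product I A) x)"
    "x \<in> carrier (product I A) \<Longrightarrow> box (ultraproduct I A U) (q x) = q (box (product I A) x)"
    "x \<in> carrier (product I A) \<Longrightarrow> y \<in> carrier (product I A) \<Longrightarrow>
      meet (ultraproduct I A U) (q x) (q y) = q (meet (product I A) x y)"
    "x \<in> carrier (product I A) \<Longrightarrow> y \<in> carrier (product I A) \<Longrightarrow>
      join (ultraproduct I A U) (q x) (q y) = q (join (product I A) x y)"
proof -
  let ?B = "product I A" and ?r = "ultra_rel I A U"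
  note eq = equiv_ultra_rel[of I A U]
  have cl: "algebra_closed ?B" by (rule algebra_closed_product) (rule closed)
  note cl' = cl[unfolded subuniverse_def]
  have r: "(x, y) \<in> ?r \<longleftrightarrow> x \<in> carrier ?B \<and> y \<in> carrier ?B \<and> eventually (\<lambda>i. x i = y i) U" for x y
    by (simp add: ultra_rel_def)
  show "carrier (ultraproduct I A U) = q ` carrier ?B"
    by (auto simp: ultraproduct_def Let_def quotient_def q_def)
  show "zero (ultraproduct I A U) = q (zero ?B)" "one (ultraproduct I A U) = q (one ?B)"
    by (simp_all add: ultraproduct_def Let_def q_def)
  show "cmpl (ultraproduct I A U) (q x) = q (cmpl ?B x)" if x: "x \<in> carrier ?B"
  proof -
    have "(\<lambda>x. ?r `` {cmpl ?B x}) respects ?r"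
    proof (rule congruentI)
      fix y z assume yz: "(y, z) \<in> ?r"
      then have "eventually (\<lambda>i. cmpl ?B y i = cmpl ?B z i) U"
        unfolding r by (auto elim: eventually_mono simp: restrict_def)
      then show "?r `` {cmpl ?B y} = ?r `` {cmpl ?B z}"
        using yz cl' by (intro equiv_class_eq[OF eq]) (simp add: r)
    qed
    from UN_equiv_class[OF eq this x] show ?thesis
      by (simp add: ultraproduct_def Let_def q_def)
  qed
  show "box (ultraproduct I A U) (q x) = q (box ?B x)" if x: "x \<in> carrier ?B"
  proof -
    have "(\<lambda>x. ?r `` {box ?B x}) respects ?r"
    proof (rule congruentI)
      fix y z assume yz: "(y, z) \<in> ?r"
      then have "eventually (\<lambda>i. box ?B y i = box ?B z i) U"
        unfolding r by (auto elim: eventually_mono simp: restrict_def)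
      then show "?r `` {box ?B y} = ?r `` {box ?B z}"
        using yz cl' by (intro equiv_class_eq[OF eq]) (simp add: r)
    qed
    from UN_equiv_class[OF eq this x] show ?thesis
      by (simp add: ultraproduct_def Let_def q_def)
  qed
  show "meet (ultraproduct I A U) (q x) (q y) = q (meet ?B x y)"
    if x: "x \<in> carrier ?B" and y: "y \<in> carrier ?B"
  proof -
    have "(\<lambda>x y. ?r `` {meet ?B x y}) respects2 ?r"
    proof (rule congruent2I')
      fix y1 z1 y2 z2 assume yz: "(y1, z1) \<in> ?r" "(y2, z2) \<in> ?r"
      then have "eventually (\<lambda>i. meet ?B y1 y2 i = meet ?B z1 z2 i) U"
        unfolding r by (auto elim: eventually_elim2 simp: restrict_def)
      then show "?r `` {meet ?B y1 y2} = ?r `` {meet ?B z1 z2}"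
        using yz cl' by (intro equiv_class_eq[OF eq]) (simp add: r)
    qed
    from UN_equiv_class2[OF eq eq this x y] show ?thesis
      by (simp add: ultraproduct_def Let_def q_def)
  qed
  show "join (ultraproduct I A U) (q x) (q y) = q (join ?B x y)"
    if x: "x \<in> carrier ?B" and y: "y \<in> carrier ?B"
  proof -
    have "(\<lambda>x y. ?r `` {join ?B x y}) respects2 ?r"
    proof (rule congruent2I')
      fix y1 z1 y2 z2 assume yz: "(y1, z1) \<in> ?r" "(y2, z2) \<in> ?r"
      then have "eventually (\<lambda>i. join ?B y1 y2 i = join ?B z1 z2 i) U"
        unfolding r by (auto elim: eventually_elim2 simp: restrict_def)
      then show "?r `` {join ?B y1 y2} = ?r `` {join ?B z1 z2}"
        using yz cl' by (intro equiv_class_eq[OF eq]) (simp add: r)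
    qed
    from UN_equiv_class2[OF eq eq this x y] show ?thesis
      by (simp add: ultraproduct_def Let_def q_def)
  qed
qed

lemma homomorphism_ultraproduct:
  assumes "\<And>i. i \<in> I \<Longrightarrow> algebra_closed (A i)" "ultrafilter_on I U"
  shows "homomorphism (product I A) (ultraproduct I A U) (\<lambda>x. ultra_rel I A U `` {x})"
proof -
  let ?B = "product I A"
  have cl: "algebra_closed ?B" by (rule algebra_closed_product) (rule assms(1))
  note simps = ultraproduct_simps[OF assms]
  have "algebra_closed (ultraproduct I A U)"
    using cl unfolding subuniverse_def simps(1) by (auto simp: simps simp del: product_simps)
  with cl show ?thesis
    unfolding homomorphism_def by (auto simp: simps simp del: product_simps)
qed

lemma variety_ultraproduct:
  assumes "\<And>i. i \<in> I \<Longrightarrow> A i \<in> variety_K4C n" "ultrafilter_on I U"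
  shows "ultraproduct I A U \<in> variety_K4C n"
proof -
  have cl: "algebra_closed (A i)" if "i \<in> I" for i
    using assms(1)[OF that] by (rule algebra_closed_normal)
  show ?thesis
    using variety_homomorphic_image[OF variety_product[of I A n] homomorphism_ultraproduct[OF cl assms(2)]]
      assms ultraproduct_simps(1)[OF cl assms(2)] by simp
qed

subsection \<open>Ultrafilters and the canonical frame\<close>

context normal_modal_algebra
begin

lemma closed_ops [simp]:
  "zero A \<in> carrier A" "one A \<in> carrier A"
  "x \<in> carrier A \<Longrightarrow> cmpl A x \<in> carrier A" "x \<in> carrier A \<Longrightarrow> box A x \<in> carrier A"
  "x \<in> carrier A \<Longrightarrow> y \<in> carrier A \<Longrightarrow> meet A x y \<in> carrier A"
  "x \<in> carrier A \<Longrightarrow> y \<in> carrier A \<Longrightarrow> join A x y \<in> carrier A"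
  using closed by (simp_all add: subuniverse_def)

lemma meet_idem: "x \<in> carrier A \<Longrightarrow> meet A x x = x"
  using meet_join_distrib[of x x "cmpl A x"] by (simp add: join_cmpl meet_cmpl meet_one join_zero)

lemma meet_zero: "x \<in> carrier A \<Longrightarrow> meet A x (zero A) = zero A"
  using meet_assoc[of x x "cmpl A x"] by (simp add: meet_cmpl meet_idem)

lemma meet_left_commute:
  "x \<in> carrier A \<Longrightarrow> y \<in> carrier A \<Longrightarrow> z \<in> carrier A \<Longrightarrow>
    meet A x (meet A y z) = meet A y (meet A x z)"
  using meet_assoc[of x y z] meet_assoc[of y x z] meet_commute[of x y] by simp

lemma meet_left_idem: "x \<in> carrier A \<Longrightarrow> y \<in> carrier A \<Longrightarrow> meet A x (meet A x y) = meet A x y"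
  using meet_assoc[of x x y] by (simp add: meet_idem)

lemmas meet_ac = meet_assoc meet_commute meet_left_commute

lemma meet_eq_if_meet_cmpl_zero:
  assumes "x \<in> carrier A" "y \<in> carrier A" "meet A x (cmpl A y) = zero A"
  shows "meet A x y = x"
  using meet_join_distrib[of x y "cmpl A y"] assms by (simp add: join_cmpl meet_one join_zero)

lemma zero_if_meets_zero:
  assumes "x \<in> carrier A" "y \<in> carrier A" "meet A x y = zero A" "meet A x (cmpl A y) = zero A"
  shows "x = zero A"
  using meet_eq_if_meet_cmpl_zero[of x y] assms by simp

end

definition filter_in :: "'a modal_algebra \<Rightarrow> 'a set \<Rightarrow> bool" where
  "filter_in A F \<longleftrightarrow> F \<subseteq> carrier A \<and> one A \<in> F \<and> (\<forall>x\<in>F. \<forall>y\<in>F. meet A x y \<in> F) \<and>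
     (\<forall>x\<in>F. \<forall>y\<in>carrier A. meet A x y = x \<longrightarrow> y \<in> F)"

text \<open>The points of the Stone space of the Boolean part of \<open>A\<close>, to be
  distinguished from the ultrafilters on index sets in \<open>ultrafilter_on\<close>.\<close>

definition ultrafilters :: "'a modal_algebra \<Rightarrow> 'a set set" where
  "ultrafilters A = {F. filter_in A F \<and> zero A \<notin> F \<and> (\<forall>x\<in>carrier A. x \<in> F \<or> cmpl A x \<in> F)}"

definition canonical_rel :: "'a modal_algebra \<Rightarrow> 'a set rel" where
  "canonical_rel A = {(F, G). F \<in> ultrafilters A \<and> G \<in> ultrafilters A \<and>
     (\<forall>x\<in>carrier A. box A x \<in> F \<longrightarrow> x \<in> G)}"

abbreviation canonical_frame :: "'a modal_algebra \<Rightarrow> 'a set set \<times> 'a set rel" where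
  "canonical_frame A \<equiv> (ultrafilters A, canonical_rel A)"

context normal_modal_algebra
begin

text \<open>Take everything above some \<open>meet A x c\<close> with x in F. The result is proper
  because none of these meets is zero, and it is closed under meets because (u meet c) meet (v meet
  c) is (u meet v) meet c.\<close>

lemma filter_adjoin:
  assumes F: "filter_in A F" and c: "c \<in> carrier A"
    and ne: "\<And>x. x \<in> F \<Longrightarrow> meet A x c \<noteq> zero A"
  shows "\<exists>G. filter_in A G \<and> zero A \<notin> G \<and> F \<subseteq> G \<and> c \<in> G"
proof -
  note F' = F[unfolded filter_in_def]
  let ?G = "{y \<in> carrier A. \<exists>x\<in>F. meet A (meet A x c) y = meet A x c}"
  have FA: "x \<in> carrier A" if "x \<in> F" for x using F' that by auto
  have meetG: "meet A y z \<in> ?G" if y: "y \<in> ?G" and z: "z \<in> ?G" for y z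
  proof -
    obtain u v where u: "u \<in> F" "meet A (meet A u c) y = meet A u c"
      and v: "v \<in> F" "meet A (meet A v c) z = meet A v c" using y z by auto
    have in_A: "u \<in> carrier A" "v \<in> carrier A" "y \<in> carrier A" "z \<in> carrier A"
      using FA u v y z by auto
    have *: "meet A (meet A u v) c = meet A (meet A u c) (meet A v c)"
      using in_A c by (simp add: meet_ac meet_left_idem meet_idem)
    have "meet A (meet A (meet A u v) c) (meet A y z)
      = meet A (meet A (meet A u c) y) (meet A (meet A v c) z)"
      unfolding * using in_A c by (simp add: meet_ac)
    also have "\<dots> = meet A (meet A u v) c" unfolding * u v ..
    finally show ?thesis using F' u v in_A by auto
  qed
  have "filter_in A ?G"
    unfolding filter_in_def
  proof (intro conjI ballI impI)
    show "one A \<in> ?G" using F' c by (auto simp: meet_one intro!: bexI[of _ "one A"])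
    fix y z assume y: "y \<in> ?G" and z: "z \<in> carrier A" "meet A y z = y"
    then obtain u where u: "u \<in> F" "meet A (meet A u c) y = meet A u c" by auto
    have "meet A (meet A u c) z = meet A (meet A u c) (meet A y z)"
      using u FA[OF u(1)] c y z(1) meet_assoc[of "meet A u c" y z] by simp
    then have "meet A (meet A u c) z = meet A u c" using z(2) u(2) by simp
    then show "z \<in> ?G" using z u by auto
  qed (use meetG in auto)
  moreover have "zero A \<notin> ?G"
  proof
    assume "zero A \<in> ?G"
    then obtain x where "x \<in> F" "zero A = meet A x c" using FA c by (auto simp: meet_zero)
    then show False using ne by metis
  qed
  moreover have "F \<subseteq> ?G"
  proof
    fix x assume x: "x \<in> F"
    then have "meet A (meet A x c) x = meet A x c"
      using FA c by (simp add: meet_ac meet_left_idem meet_idem)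
    then show "x \<in> ?G" using x FA by auto
  qed
  moreover have "c \<in> ?G"
    using F' c by (auto intro!: bexI[of _ "one A"] simp: meet_assoc meet_idem)
  ultimately show ?thesis by blast
qed

text \<open>Zorn's lemma gives a maximal proper filter M above F. If M contained neither c nor its
  complement, then by maximality c would be disjoint from some x in M and the complement from some y
  in M. Then \<open>meet A x y\<close> would be disjoint from both, hence zero, although it lies in
  M.\<close>

lemma ultrafilter_extension:
  assumes F: "filter_in A F" "zero A \<notin> F"
  shows "\<exists>G \<in> ultrafilters A. F \<subseteq> G"
proof -
  let ?P = "{G. filter_in A G \<and> zero A \<notin> G \<and> F \<subseteq> G}"
  have "\<exists>M\<in>?P. \<forall>G\<in>?P. M \<subseteq> G \<longrightarrow> G = M"
  proof (rule subset_Zorn_nonempty)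
    show "?P \<noteq> {}" using F by blast
    fix \<C> assume ne: "\<C> \<noteq> {}" and ch: "subset.chain ?P \<C>"
    then have sub: "\<C> \<subseteq> ?P" by (simp add: subset.chain_def)
    have "meet A x y \<in> \<Union>\<C>" if xy: "x \<in> \<Union>\<C>" "y \<in> \<Union>\<C>" for x y
    proof -
      obtain G H where GH: "G \<in> \<C>" "x \<in> G" "H \<in> \<C>" "y \<in> H" using xy by blast
      then have "G \<subseteq> H \<or> H \<subseteq> G" using ch by (auto simp: subset_chain_def)
      then obtain K where "K \<in> \<C>" "x \<in> K" "y \<in> K" using GH by blast
      then have "filter_in A K" using sub by auto
      then have "meet A x y \<in> K" using \<open>x \<in> K\<close> \<open>y \<in> K\<close> by (simp add: filter_in_def)
      then show ?thesis using \<open>K \<in> \<C>\<close> by (rule UnionI[rotated])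
    qed
    moreover have fi: "filter_in A G" if "G \<in> \<C>" for G using that sub by auto
    moreover have "\<Union>\<C> \<subseteq> carrier A" using fi unfolding filter_in_def by blast
    moreover obtain G where "G \<in> \<C>" using ne by auto
    moreover from this have "one A \<in> \<Union>\<C>" using fi[of G] by (auto simp: filter_in_def)
    moreover have "y \<in> \<Union>\<C>" if xy: "x \<in> \<Union>\<C>" "y \<in> carrier A" "meet A x y = x" for x y
    proof -
      obtain G where G: "G \<in> \<C>" "x \<in> G" using xy by blast
      then have "y \<in> G" using fi[OF G(1)] xy unfolding filter_in_def by metis
      then show ?thesis using G by blast
    qed
    ultimately have "filter_in A (\<Union>\<C>)"
      unfolding filter_in_def by (intro conjI ballI impI)
    then show "\<Union>\<C> \<in> ?P" using ne sub by auto
  qed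
  then obtain M where M: "filter_in A M" "zero A \<notin> M" "F \<subseteq> M"
    and max: "\<And>G. filter_in A G \<Longrightarrow> zero A \<notin> G \<Longrightarrow> F \<subseteq> G \<Longrightarrow> M \<subseteq> G \<Longrightarrow> G = M"
    by (simp add: Bex_def Ball_def) metis
  note M' = M(1)[unfolded filter_in_def]
  have avoid: "\<exists>x\<in>M. meet A x c = zero A" if c: "c \<in> carrier A" "c \<notin> M" for c
    using filter_adjoin[OF M(1) c(1)] max M(3) c(2) by (metis subset_trans)
  have "c \<in> M \<or> cmpl A c \<in> M" if c: "c \<in> carrier A" for c
  proof (rule ccontr)
    assume "\<not> (c \<in> M \<or> cmpl A c \<in> M)"
    then obtain x y where x: "x \<in> M" "meet A x c = zero A"
      and y: "y \<in> M" "meet A y (cmpl A c) = zero A"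
      using avoid[of c] avoid[of "cmpl A c"] c by auto
    have xy: "x \<in> carrier A" "y \<in> carrier A" using M' x y by auto
    have "meet A (meet A x y) c = meet A y (meet A x c)"
      using xy c by (simp add: meet_ac)
    moreover have "meet A (meet A x y) (cmpl A c) = meet A x (meet A y (cmpl A c))"
      using xy c by (simp add: meet_assoc)
    ultimately have "meet A x y = zero A"
      using zero_if_meets_zero[of "meet A x y" c] xy c x y by (simp add: meet_zero)
    moreover have "meet A x y \<in> M" using M' x(1) y(1) by blast
    ultimately show False using M(2) by simp
  qed
  then have "M \<in> ultrafilters A" using M by (simp add: ultrafilters_def)
  then show ?thesis using M by blast
qed

lemma ultrafilter_adjoin:
  assumes "filter_in A F" "c \<in> carrier A" "\<And>x. x \<in> F \<Longrightarrow> meet A x c \<noteq> zero A"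
  shows "\<exists>G \<in> ultrafilters A. F \<subseteq> G \<and> c \<in> G"
proof -
  obtain G where "filter_in A G" "zero A \<notin> G" "F \<subseteq> G" "c \<in> G" using filter_adjoin[OF assms] by blast
  then show ?thesis using ultrafilter_extension[of G] by blast
qed

lemma ultrafilter_iff:
  assumes F: "F \<in> ultrafilters A"
  shows "zero A \<notin> F" "one A \<in> F"
    "x \<in> carrier A \<Longrightarrow> cmpl A x \<in> F \<longleftrightarrow> x \<notin> F"
    "x \<in> carrier A \<Longrightarrow> y \<in> carrier A \<Longrightarrow> meet A x y \<in> F \<longleftrightarrow> x \<in> F \<and> y \<in> F"
    "x \<in> carrier A \<Longrightarrow> y \<in> carrier A \<Longrightarrow> join A x y \<in> F \<longleftrightarrow> x \<in> F \<or> y \<in> F"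
proof -
  note F' = F[unfolded ultrafilters_def filter_in_def, simplified]
  show zero: "zero A \<notin> F" and "one A \<in> F" using F' by auto
  have up: "y \<in> F" if "x \<in> F" "y \<in> carrier A" "meet A x y = x" for x y using F' that by blast
  have mt: "meet A x y \<in> F" if "x \<in> F" "y \<in> F" for x y using F' that by blast
  show cm: "cmpl A x \<in> F \<longleftrightarrow> x \<notin> F" if x: "x \<in> carrier A" for x
    using F' x mt[of x "cmpl A x"] zero by (auto simp: meet_cmpl)
  show meet: "meet A x y \<in> F \<longleftrightarrow> x \<in> F \<and> y \<in> F"
    if x: "x \<in> carrier A" and y: "y \<in> carrier A" for x y
  proof
    assume "meet A x y \<in> F"
    moreover have "meet A (meet A x y) x = meet A x y"
      using x y by (simp add: meet_ac meet_left_idem meet_idem)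
    moreover have "meet A (meet A x y) y = meet A x y"
      using x y by (simp add: meet_ac meet_left_idem meet_idem)
    ultimately show "x \<in> F \<and> y \<in> F" using up x y by blast
  qed (use mt in blast)
  show "join A x y \<in> F \<longleftrightarrow> x \<in> F \<or> y \<in> F"
    if x: "x \<in> carrier A" and y: "y \<in> carrier A" for x y
  proof
    assume j: "join A x y \<in> F"
    show "x \<in> F \<or> y \<in> F"
    proof (rule ccontr)
      assume "\<not> (x \<in> F \<or> y \<in> F)"
      then have F3: "meet A (meet A (cmpl A x) (cmpl A y)) (join A x y) \<in> F"
        using j cm mt x y by auto
      have "meet A (meet A (cmpl A x) (cmpl A y)) x = meet A (cmpl A y) (meet A x (cmpl A x))"
        using x y by (simp add: meet_ac)
      moreover have "meet A (meet A (cmpl A x) (cmpl A y)) y = meet A (cmpl A x) (meet A y (cmpl A y))"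
        using x y by (simp add: meet_ac)
      ultimately have "meet A (meet A (cmpl A x) (cmpl A y)) (join A x y) = zero A"
        using x y by (simp add: meet_join_distrib meet_cmpl meet_zero join_zero)
      then show False using F3 zero by simp
    qed
  next
    \<comment> \<open>Absorption is derived from distributivity, once joining with
      \<open>one A\<close> is known to give \<open>one A\<close>.\<close>
    have "meet A x (join A x y) = x" if "x \<in> carrier A" "y \<in> carrier A" for x y
    proof -
      have "meet A x (join A x y) = join A (meet A x (one A)) (meet A x y)"
        using that by (simp add: meet_join_distrib meet_one meet_idem)
      also have "\<dots> = meet A x (join A (one A) y)"
        using that by (simp add: meet_join_distrib)
      also have "join A (one A) y = one A"
      proof -
        have "join A y (one A) = meet A (join A y (one A)) (join A y (cmpl A y))"
          using that by (simp add: meet_one join_cmpl)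
        also have "\<dots> = join A y (meet A (one A) (cmpl A y))"
          using that by (simp add: join_meet_distrib)
        also have "\<dots> = one A"
          using that by (simp add: meet_commute[of "one A"] meet_one join_cmpl)
        finally show ?thesis using that by (simp add: join_commute)
      qed
      finally show ?thesis using that by (simp add: meet_one)
    qed
    from this[OF x y] this[OF y x]
    have "x \<in> F \<Longrightarrow> join A x y \<in> F" "y \<in> F \<Longrightarrow> join A x y \<in> F"
      using up x y by (auto simp: join_commute[of y x])
    then show "x \<in> F \<or> y \<in> F \<Longrightarrow> join A x y \<in> F" by blast
  qed
qed

text \<open>The truth lemma for the box. If \<open>box A a\<close> is not in F, then the complement
  of a can be adjoined to the filter of all x with \<open>box A x\<close> in F: an x disjoint from
  that complement would lie below a, and monotonicity would put \<open>box A a\<close> into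
  F.\<close>

lemma ultrafilter_box:
  assumes F: "F \<in> ultrafilters A" and a: "a \<in> carrier A"
  shows "box A a \<in> F \<longleftrightarrow> (\<forall>G. (F, G) \<in> canonical_rel A \<longrightarrow> a \<in> G)"
proof
  assume R: "\<forall>G. (F, G) \<in> canonical_rel A \<longrightarrow> a \<in> G"
  note F_iff = ultrafilter_iff[OF F]
  have mono: "box A y \<in> F" if "box A x \<in> F" "x \<in> carrier A" "y \<in> carrier A" "meet A x y = x" for x y
    using that box_meet[of x y] F_iff(4)[of "box A x" "box A y"] by simp
  show "box A a \<in> F"
  proof (rule ccontr)
    assume na: "box A a \<notin> F"
    have "filter_in A {x \<in> carrier A. box A x \<in> F}"
      unfolding filter_in_def using mono F_iff by (auto simp: box_one box_meet)
    moreover have "meet A x (cmpl A a) \<noteq> zero A" if "x \<in> {x \<in> carrier A. box A x \<in> F}" for x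
      using that meet_eq_if_meet_cmpl_zero[of x a] mono[of x a] a na by auto
    ultimately obtain G where G: "G \<in> ultrafilters A" "{x \<in> carrier A. box A x \<in> F} \<subseteq> G" "cmpl A a \<in> G"
      using ultrafilter_adjoin[of "{x \<in> carrier A. box A x \<in> F}" "cmpl A a"] a by auto
    then have "(F, G) \<in> canonical_rel A" using F by (auto simp: canonical_rel_def)
    then show False using R G ultrafilter_iff(3)[OF G(1) a] by blast
  qed
qed (use a in \<open>auto simp: canonical_rel_def\<close>)

text \<open>Of two distinct elements, one has a nonzero meet with the complement of the other; an
  ultrafilter through this meet, obtained from the trivial filter, separates them.\<close>

lemma ultrafilter_separation:
  assumes "a \<in> carrier A" "b \<in> carrier A" "a \<noteq> b"
  shows "\<exists>F \<in> ultrafilters A. (a \<in> F) \<noteq> (b \<in> F)"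
proof -
  have *: "\<exists>F \<in> ultrafilters A. x \<in> F \<and> y \<notin> F"
    if xy: "x \<in> carrier A" "y \<in> carrier A" "meet A x (cmpl A y) \<noteq> zero A" for x y
  proof -
    have "filter_in A {one A}"
      using meet_commute[of "one A"] by (auto simp: filter_in_def meet_one)
    moreover have "meet A (one A) (meet A x (cmpl A y)) = meet A x (cmpl A y)"
      using xy by (simp add: meet_commute[of "one A"] meet_one)
    ultimately obtain F where "F \<in> ultrafilters A" "meet A x (cmpl A y) \<in> F"
      using ultrafilter_adjoin[of "{one A}" "meet A x (cmpl A y)"] xy by auto
    then show ?thesis using xy ultrafilter_iff by (metis closed_ops(3))
  qed
  have "meet A a (cmpl A b) \<noteq> zero A \<or> meet A b (cmpl A a) \<noteq> zero A"
    using meet_eq_if_meet_cmpl_zero assms by (metis meet_commute)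
  then show ?thesis using *[of a b] *[of b a] assms by blast
qed

text \<open>The representation of Jonsson and Tarski: Stone's theorem for the Boolean operations,
  the truth lemma for the box.\<close>

lemma homomorphism_canonical:
  "homomorphism A (complex_algebra (canonical_frame A)) (\<lambda>a. {F \<in> ultrafilters A. a \<in> F})"
proof -
  have R: "canonical_rel A \<subseteq> ultrafilters A \<times> ultrafilters A" by (auto simp: canonical_rel_def)
  have box: "{F \<in> ultrafilters A. box A x \<in> F} =
      {F \<in> ultrafilters A. \<forall>G. (F, G) \<in> canonical_rel A \<longrightarrow> G \<in> {G \<in> ultrafilters A. x \<in> G}}"
    if "x \<in> carrier A" for x
    using ultrafilter_box[OF _ that] R by blast
  show ?thesis
    unfolding homomorphism_def
  proof (intro conjI ballI)
    show "algebra_closed (complex_algebra (canonical_frame A))"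
      using normal_modal_algebra.closed[OF normal_complex_algebra[OF R]] by simp
  qed (use closed box in \<open>auto simp: ultrafilter_iff\<close>)
qed

lemma inj_on_canonical:
  "inj_on (\<lambda>a. {F \<in> ultrafilters A. a \<in> F}) (carrier A)"
proof (rule inj_onI)
  fix a b assume ab: "a \<in> carrier A" "b \<in> carrier A"
    and "{F \<in> ultrafilters A. a \<in> F} = {F \<in> ultrafilters A. b \<in> F}"
  then have "\<forall>F \<in> ultrafilters A. (a \<in> F) = (b \<in> F)" by blast
  then show "a = b" using ultrafilter_separation[OF ab] by blast
qed

end

lemma variety_valid:
  "A \<in> variety_K4C n \<Longrightarrow> \<phi> \<in> K4C n \<Longrightarrow> range \<theta> \<subseteq> carrier A \<Longrightarrow> eval A \<theta> \<phi> = one A"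
  by (simp add: variety_K4C_def valid_in_def)

lemma K4C_axioms: "Imp (Box \<phi>) (Box (Box \<phi>)) \<in> K4C n" "fmC n \<psi> \<in> K4C n"
  by (auto simp: K4C_def)

text \<open>The axiom 4 is canonical: \<open>box A x\<close> in F yields
  \<open>box A (box A x)\<close> in F, hence \<open>box A x\<close> in G, hence x in H. An instance
  with a single element of \<open>A\<close> is enough for this.\<close>

lemma trans_canonical_rel:
  assumes "A \<in> variety_K4C n"
  shows "trans (canonical_rel A)"
proof (rule transI)
  interpret normal_modal_algebra A using assms by (simp add: variety_K4C_def)
  fix F G H assume R: "(F, G) \<in> canonical_rel A" "(G, H) \<in> canonical_rel A"
  then have F: "F \<in> ultrafilters A" by (simp add: canonical_rel_def)
  have "x \<in> H" if x: "x \<in> carrier A" "box A x \<in> F" for x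
  proof -
    have "eval A (\<lambda>_. x) (Imp (Box (Var 0)) (Box (Box (Var 0)))) = one A"
      using x(1) by (intro variety_valid[OF assms K4C_axioms(1)]) auto
    then have "eval A (\<lambda>_. x) (Imp (Box (Var 0)) (Box (Box (Var 0)))) \<in> F"
      using ultrafilter_iff(2)[OF F] by (rule ssubst)
    then have "box A (box A x) \<in> F"
      using x by (simp add: ultrafilter_iff(3,4)[OF F])
    then show ?thesis using R x by (auto simp: canonical_rel_def)
  qed
  then show "(F, H) \<in> canonical_rel A" using R by (auto simp: canonical_rel_def)
qed

subsection \<open>Finite embeddability\<close>

text \<open>Asking for an operation only where its value stays in X is what an ultraproduct can use:
  each single instance of an operation involves finitely many elements.\<close>

definition partial_embedding ::
    "'a modal_algebra \<Rightarrow> 'a set \<Rightarrow> 'b modal_algebra \<Rightarrow> ('a \<Rightarrow> 'b) \<Rightarrow> bool" where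
  "partial_embedding A X B h \<longleftrightarrow> h ` X \<subseteq> carrier B \<and> inj_on h X \<and>
     (zero A \<in> X \<longrightarrow> h (zero A) = zero B) \<and> (one A \<in> X \<longrightarrow> h (one A) = one B) \<and>
     (\<forall>x\<in>X. (cmpl A x \<in> X \<longrightarrow> h (cmpl A x) = cmpl B (h x)) \<and>
       (box A x \<in> X \<longrightarrow> h (box A x) = box B (h x))) \<and>
     (\<forall>x\<in>X. \<forall>y\<in>X. (meet A x y \<in> X \<longrightarrow> h (meet A x y) = meet B (h x) (h y)) \<and>
       (join A x y \<in> X \<longrightarrow> h (join A x y) = join B (h x) (h y)))"

lemma partial_embedding_homomorphism:
  assumes g: "homomorphism A B g" "inj_on g (carrier A)" "X \<subseteq> carrier A"
    and h: "partial_embedding B (g ` X) C h"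
  shows "partial_embedding A X C (h \<circ> g)"
proof -
  have XA: "x \<in> carrier A" if "x \<in> X" for x using g(3) that by blast
  have gX: "y \<in> g ` X" if "x \<in> X" "g x = y" for x y using that by blast
  note g' = g(1)[unfolded homomorphism_def] and h' = h[unfolded partial_embedding_def]
  have "h (g (zero A)) = zero C" if "zero A \<in> X"
    using gX[OF that, of "zero B"] g' h' by simp
  moreover have "h (g (one A)) = one C" if "one A \<in> X"
    using gX[OF that, of "one B"] g' h' by simp
  moreover have "h (g (cmpl A x)) = cmpl C (h (g x))" if "x \<in> X" "cmpl A x \<in> X" for x
    using gX[OF that(2), of "cmpl B (g x)"] g' h' XA that by simp
  moreover have "h (g (box A x)) = box C (h (g x))" if "x \<in> X" "box A x \<in> X" for x
    using gX[OF that(2), of "box B (g x)"] g' h' XA that by simp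
  moreover have "h (g (meet A x y)) = meet C (h (g x)) (h (g y))"
    if "x \<in> X" "y \<in> X" "meet A x y \<in> X" for x y
    using gX[OF that(3), of "meet B (g x) (g y)"] g' h' XA that by simp
  moreover have "h (g (join A x y)) = join C (h (g x)) (h (g y))"
    if "x \<in> X" "y \<in> X" "join A x y \<in> X" for x y
    using gX[OF that(3), of "join B (g x) (g y)"] g' h' XA that by simp
  moreover have "inj_on (h \<circ> g) X"
    using h' g(2,3) by (intro comp_inj_on) (auto intro: inj_on_subset)
  moreover have "(h \<circ> g) ` X \<subseteq> carrier C" using h' by (simp add: image_comp)
  ultimately show ?thesis unfolding partial_embedding_def by simp
qed

lemma homomorphism_partial_embedding:
  assumes h: "partial_embedding A X B h" and g: "homomorphism B C g" "inj_on g (carrier B)"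
  shows "partial_embedding A X C (g \<circ> h)"
proof -
  note g' = g(1)[unfolded homomorphism_def] and h' = h[unfolded partial_embedding_def]
  have hX: "h x \<in> carrier B" if "x \<in> X" for x using h' that by blast
  have "inj_on (g \<circ> h) X"
    using h' g(2) by (intro comp_inj_on) (auto intro: inj_on_subset)
  moreover have "(g \<circ> h) ` X \<subseteq> carrier C" using g' hX by auto
  ultimately show ?thesis unfolding partial_embedding_def using g' h' hX by simp
qed

lemma homomorphism_complex_image:
  assumes R: "R \<subseteq> W \<times> W" and f: "inj_on f W"
  shows "homomorphism (complex_algebra (W, R))
    (complex_algebra (f ` W, map_prod f f ` R)) ((`) f)"
proof -
  have R': "map_prod f f ` R \<subseteq> f ` W \<times> f ` W" using R by auto
  have box: "f ` {x \<in> W. \<forall>y. (x, y) \<in> R \<longrightarrow> y \<in> X} =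
      {x \<in> f ` W. \<forall>y. (x, y) \<in> map_prod f f ` R \<longrightarrow> y \<in> f ` X}" (is "?L = ?R")
    if X: "X \<subseteq> W" for X
  proof -
    have *: "(\<forall>v. (f x, v) \<in> map_prod f f ` R \<longrightarrow> v \<in> f ` X) \<longleftrightarrow> (\<forall>y. (x, y) \<in> R \<longrightarrow> y \<in> X)"
      if x: "x \<in> W" for x
    proof (intro iffI allI impI)
      fix y assume v: "\<forall>v. (f x, v) \<in> map_prod f f ` R \<longrightarrow> v \<in> f ` X" and xy: "(x, y) \<in> R"
      have "f y \<in> f ` X" using v imageI[OF xy, of "map_prod f f"] by simp
      then show "y \<in> X" using inj_on_image_mem_iff[OF f _ X] xy R by blast
    next
      fix v assume y: "\<forall>y. (x, y) \<in> R \<longrightarrow> y \<in> X" and v: "(f x, v) \<in> map_prod f f ` R"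
      from v obtain p where p: "(f x, v) = map_prod f f p" "p \<in> R" by (rule imageE)
      then obtain a b where ab: "(a, b) \<in> R" "f x = f a" "v = f b" by (cases p) simp
      then have "a = x" using inj_onD[OF f, of a x] R x by auto
      then show "v \<in> f ` X" using ab y by simp
    qed
    show ?thesis
    proof (intro equalityI subsetI)
      fix u assume "u \<in> ?L"
      then obtain x where "x \<in> W" "u = f x" "\<forall>y. (x, y) \<in> R \<longrightarrow> y \<in> X" by blast
      then show "u \<in> ?R" using *[of x] by simp
    next
      fix u assume u: "u \<in> ?R"
      then obtain x where "x \<in> W" "u = f x" by blast
      then show "u \<in> ?L" using u *[of x] by simp
    qed
  qed
  have "f ` (W - X) = f ` W - f ` X" if "X \<subseteq> W" for X
    using f that by (intro inj_on_image_set_diff) auto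
  moreover have "f ` (X \<inter> Y) = f ` X \<inter> f ` Y" if "X \<subseteq> W" "Y \<subseteq> W" for X Y
    using f that by (rule inj_on_image_Int)
  ultimately show ?thesis
    unfolding homomorphism_def
    using normal_modal_algebra.closed[OF normal_complex_algebra[OF R]]
      normal_modal_algebra.closed[OF normal_complex_algebra[OF R']] box
    by (simp add: image_Un image_mono Pi_iff)
qed

text \<open>A type class is a finite intersection of members of X and complements of members of X,
  or empty. Staying in B matters because the axiom will be assumed only for valuations with values
  in B.\<close>

lemma type_class_in_subuniverse:
  assumes "subuniverse B (complex_algebra (W, R))" "finite X" "X \<subseteq> B"
  shows "{v \<in> W. {a \<in> X. v \<in> a} = \<tau>} \<in> B"
  using assms(2,3)
proof (induction X arbitrary: \<tau>)
  case empty
  then show ?case using assms(1) by (cases "\<tau> = {}") (auto simp: subuniverse_def)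
next
  case (insert a X)
  have a: "a \<in> B" "W - a \<in> B" "a \<subseteq> W" using insert.prems assms(1) by (auto simp: subuniverse_def)
  have int: "x \<inter> y \<in> B" if "x \<in> B" "y \<in> B" for x y using that assms(1) by (simp add: subuniverse_def)
  let ?S = "\<lambda>\<sigma>. {v \<in> W. {a \<in> X. v \<in> a} = \<sigma>}"
  have "{v \<in> W. {b \<in> insert a X. v \<in> b} = \<tau>} =
    (if a \<in> \<tau> then a \<inter> ?S (\<tau> - {a}) else (W - a) \<inter> ?S \<tau>)"
    using insert.hyps(2) a(3) by auto
  then show ?case using a int insert.IH insert.prems by simp
qed

text \<open>Worlds are identified when they have the same type, i.e. belong to the same members of
  \<open>X\<close>, and the same set of types of successors. Call a type essential at \<open>w\<close> if
  all successors of \<open>w\<close> of this type still see all the types that \<open>w\<close> sees. By the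
  axiom \<open>C\<^sub>n\<close> there are at most \<open>n\<close> of them. A type that is not essential has a witness that
  sees fewer types, so within a cluster it suffices to keep the arrows into essential types.\<close>

lemma finite_partial_embedding_frame:
  fixes W :: "'w set"
  assumes R: "R \<subseteq> W \<times> W" "trans R" and B: "subuniverse B (complex_algebra (W, R))"
    and C: "\<forall>\<theta>. range \<theta> \<subseteq> B \<longrightarrow> eval (complex_algebra (W, R)) \<theta> (fmC n Var) = W"
    and X: "finite X" "X \<subseteq> B"
  shows "\<exists>F \<in> circum_frames n. \<exists>h. partial_embedding (complex_algebra (W, R)) X
    (complex_algebra (F :: ('w set set \<times> 'w set set set) set \<times> ('w set set \<times> 'w set set set) rel)) h"
proof -
  define ty where "ty v = {a \<in> X. v \<in> a}" for v
  define T where "T v = ty ` (R `` {v})" for v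
  define E where "E w = {\<tau> \<in> T w. \<forall>v. (w, v) \<in> R \<longrightarrow> ty v = \<tau> \<longrightarrow> T v = T w}" for w
  have XW: "X \<subseteq> Pow W" using X B by (auto simp: subuniverse_def)
  have T_mono: "T v \<subseteq> T w" if "(w, v) \<in> R" for v w
    using that R(2) by (auto simp: T_def dest: transD)
  have ty_X: "ty v \<in> Pow X" and T_X: "T v \<in> Pow (Pow X)" for v by (auto simp: ty_def T_def)
  have fin_E: "finite (E w)" for w
    by (rule finite_subset[of _ "Pow X"]) (use X T_X in \<open>auto simp: E_def\<close>)
  \<comment> \<open>Take the classes of n+1 essential types as the propositions of the axiom.
    Different types exclude each other, so \<open>fmD\<close> holds everywhere, and the axiom yields
    a successor y of w that has type 0 and refutes \<open>fmP\<close>.\<close>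
  have card_E: "card (E w) \<le> n" if w: "w \<in> W" for w
  proof (rule ccontr)
    assume "\<not> card (E w) \<le> n"
    then obtain Z where Z: "Z \<subseteq> E w" "card Z = Suc n" "finite Z"
      by (metis not_less_eq_eq obtain_subset_with_card_n)
    then obtain \<tau> where "bij_betw \<tau> {0..<Suc n} Z" using ex_bij_betw_nat_finite[of Z] by auto
    then have inj: "inj_on \<tau> {0..<Suc n}" and \<tau>E: "\<And>i. i \<le> n \<Longrightarrow> \<tau> i \<in> E w"
      using Z(1) by (auto simp: bij_betw_def)
    \<comment> \<open>The empty set for the variables beyond n keeps the whole valuation inside
      B.\<close>
    define \<theta> where "\<theta> i = (if i \<le> n then {v \<in> W. ty v = \<tau> i} else {})" for i
    let ?V = "eval (complex_algebra (W, R)) \<theta>"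
    have "\<theta> i \<in> B" for i
      using type_class_in_subuniverse[OF B X] B by (auto simp: \<theta>_def ty_def subuniverse_def)
    then have "w \<in> ?V (fmC n Var)" using C w by auto
    moreover have D: "x \<in> ?V (fmD n Var)" if "x \<in> W" for x
      unfolding eval_fmD[OF that] using inj by (auto simp: \<theta>_def dest: inj_onD)
    moreover have "\<exists>y. (w, y) \<in> R \<and> y \<in> ?V (Var 0)"
      using \<tau>E[of 0] R(1) by (auto simp: E_def T_def \<theta>_def)
    ultimately obtain y where y: "(w, y) \<in> R" "y \<in> \<theta> 0" "y \<notin> ?V (fmP (Var 0) (map Var [1..<Suc n]))"
      unfolding eval_fmC[OF R(1) w] using w R(1) by (auto simp del: upt_Suc)
    \<comment> \<open>Every point of ?Q sees all n+1 types, as w does, and it sees them inside ?Q: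
      the points below w of a type essential at w see as many types as w. So \<open>fmP\<close>
      holds throughout ?Q, and y belongs to ?Q because type 0 is essential.\<close>
    let ?Q = "{v. (w, v) \<in> R \<and> T v = T w}"
    have "?Q \<subseteq> ?V (fmP (Var 0) (map Var [1..<Suc n]))"
    proof (rule eval_fmP_coinduct[OF R(1)])
      show "?Q \<subseteq> W" using R by auto
      fix x \<phi> assume x: "x \<in> ?Q" and "\<phi> \<in> set (Var 0 # map Var [1..<Suc n])"
      then obtain i where i: "\<phi> = Var i" "i \<le> n" by (auto simp: less_Suc_eq_le simp del: upt_Suc)
      have "\<tau> i \<in> T x" using \<tau>E[OF i(2)] x by (auto simp: E_def)
      then obtain v where v: "(x, v) \<in> R" "ty v = \<tau> i" by (auto simp: T_def)
      moreover have "(w, v) \<in> R" using x v R(2) by (auto dest: transD)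
      moreover have "T v = T w" using \<tau>E[OF i(2)] v \<open>(w, v) \<in> R\<close> by (auto simp: E_def)
      ultimately show "\<exists>y\<in>?Q. (x, y) \<in> R \<and> y \<in> ?V \<phi>"
        using i R(1) by (intro bexI[of _ v]) (auto simp: \<theta>_def)
    qed
    moreover have "y \<in> ?Q" using y \<tau>E[of 0] by (auto simp: E_def \<theta>_def)
    ultimately show False using y by blast
  qed
  define W' where "W' = (\<lambda>w. (ty w, T w)) ` W"
  \<comment> \<open>Which types are essential depends on the world and not only on the types it
    sees. One world is fixed for each set S of types, so that all arrows between points with second
    component S lead to the same at most n points.\<close>
  define pick where "pick S = (SOME w. w \<in> W \<and> T w = S)" for S
  have pick: "pick (T w) \<in> W" "T (pick (T w)) = T w" if "w \<in> W" for w
    using someI[of "\<lambda>v. v \<in> W \<and> T v = T w" w] that by (simp_all add: pick_def)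
  define R' where "R' = {(p, q). p \<in> W' \<and> q \<in> W' \<and> fst q \<in> snd p \<and>
    (snd q \<subset> snd p \<or> snd q = snd p \<and> fst q \<in> E (pick (snd p)))}"
  have circum: "(W', R') \<in> circum_frames n"
  proof (rule circum_framesI)
    have "W' \<subseteq> Pow X \<times> Pow (Pow X)" using ty_X T_X unfolding W'_def by blast
    then show "finite W'" by (rule finite_subset) (simp add: X(1))
    show "R' \<subseteq> W' \<times> W'" by (auto simp: R'_def)
    \<comment> \<open>Second components never grow along an arrow, and when they stay the same the
      essentiality condition concerns only the target and this common component.\<close>
    show tr: "trans R'" unfolding R'_def trans_def by auto
    fix xs assume xs: "is_cycle W' R' xs"
    then obtain p where p: "p \<in> set xs" by (cases xs) (auto simp: is_cycle_def)
    then obtain w where w: "w \<in> W" "p = (ty w, T w)" using xs by (auto simp: is_cycle_def W'_def)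
    have rel: "(q, r) \<in> R'" if "q \<in> set xs" "r \<in> set xs" for q r
      using cycle_related[OF tr xs that] .
    \<comment> \<open>Mutual arrows force equal second components, so no arrow on the cycle can be
      one of the strictly decreasing kind. Each point is the target of such an arrow, hence its type
      is essential.\<close>
    have "set xs \<subseteq> E (pick (snd p)) \<times> {snd p}"
    proof
      fix q assume "q \<in> set xs"
      then have "(p, q) \<in> R'" "(q, p) \<in> R'" using rel p by auto
      then show "q \<in> E (pick (snd p)) \<times> {snd p}" by (cases q) (auto simp: R'_def)
    qed
    then have "card (set xs) \<le> card (E (pick (snd p)) \<times> {snd p})"
      by (intro card_mono) (use fin_E in auto)
    also have "\<dots> \<le> n" using card_E[OF pick(1)[OF w(1)]] w(2) by (simp add: card_cartesian_product)
    finally show "length xs \<le> n" using xs by (simp add: is_cycle_def distinct_card)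
  qed
  have succ: "fst ` (R' `` {(ty w, T w)}) = T w" if w: "w \<in> W" for w
  proof
    show "fst ` (R' `` {(ty w, T w)}) \<subseteq> T w" by (auto simp: R'_def)
    show "T w \<subseteq> fst ` (R' `` {(ty w, T w)})"
    proof
      fix \<tau> assume \<tau>: "\<tau> \<in> T w"
      let ?u = "pick (T w)"
      \<comment> \<open>If \<tau> is essential at ?u, any successor of type \<tau> will do.
        Otherwise one of them sees other types than ?u, and by transitivity strictly fewer. Either
        way the arrow survives in \<open>R'\<close>. The successor is taken below ?u instead of w,
        which is harmless as both see the same types.\<close>
      obtain v where v: "(?u, v) \<in> R" "ty v = \<tau>" "T v = T ?u \<longrightarrow> \<tau> \<in> E ?u"
      proof (cases "\<tau> \<in> E ?u")
        case True
        then have "\<tau> \<in> T ?u" by (simp add: E_def)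
        then obtain v where "(?u, v) \<in> R" "ty v = \<tau>" by (auto simp: T_def)
        then show ?thesis using that True by simp
      next
        case False
        moreover have "\<tau> \<in> T ?u" using \<tau> pick(2)[OF w] by simp
        ultimately obtain v where "(?u, v) \<in> R" "ty v = \<tau>" "T v \<noteq> T ?u"
          unfolding E_def by blast
        then show ?thesis using that by simp
      qed
      have "v \<in> W" "T v \<subseteq> T w" using v R(1) T_mono[OF v(1)] pick(2)[OF w] by auto
      then have "((ty w, T w), (\<tau>, T v)) \<in> R'"
        using v w \<tau> pick(2)[OF w] by (auto simp: R'_def W'_def)
      then show "\<tau> \<in> fst ` (R' `` {(ty w, T w)})" by force
    qed
  qed
  define h where "h a = {p \<in> W'. a \<in> fst p}" for a
  have h: "(ty w, T w) \<in> h a \<longleftrightarrow> w \<in> a" if "w \<in> W" "a \<in> X" for a w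
    using that by (auto simp: h_def W'_def ty_def)
  have h_eq: "h a = Z" if "a \<in> X" "Z \<subseteq> W'" "\<And>w. w \<in> W \<Longrightarrow> w \<in> a \<longleftrightarrow> (ty w, T w) \<in> Z" for a Z
  proof (rule set_eqI)
    fix p
    show "p \<in> h a \<longleftrightarrow> p \<in> Z"
    proof (cases "p \<in> W'")
      case True
      then obtain w where "w \<in> W" "p = (ty w, T w)" unfolding W'_def by blast
      then show ?thesis using h[of w a] that by simp
    next
      case False
      moreover have "p \<notin> h a" using False by (simp add: h_def)
      ultimately show ?thesis using that(2) by blast
    qed
  qed
  \<comment> \<open>Both sides depend on w only through the set of types of its successors, and
    \<open>succ\<close> says that this set is unchanged by the thinning.\<close>
  have h_box: "h (box (complex_algebra (W, R)) a) = box (complex_algebra (W', R')) (h a)"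
    if a: "a \<in> X" "box (complex_algebra (W, R)) a \<in> X" for a
  proof (rule h_eq[OF a(2)])
    fix w assume w: "w \<in> W"
    have "w \<in> box (complex_algebra (W, R)) a \<longleftrightarrow> (\<forall>\<tau>\<in>T w. a \<in> \<tau>)"
      using w a by (auto simp: T_def ty_def)
    also have "\<dots> \<longleftrightarrow> (\<forall>\<tau> \<in> fst ` (R' `` {(ty w, T w)}). a \<in> \<tau>)" by (simp only: succ[OF w])
    also have "\<dots> \<longleftrightarrow> (ty w, T w) \<in> box (complex_algebra (W', R')) (h a)"
      using w by (auto simp: W'_def h_def R'_def)
    finally show "w \<in> box (complex_algebra (W, R)) a \<longleftrightarrow>
      (ty w, T w) \<in> box (complex_algebra (W', R')) (h a)" .
  qed auto
  have "inj_on h X"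
  proof (rule inj_onI)
    fix a b assume ab: "a \<in> X" "b \<in> X" "h a = h b"
    then have "w \<in> a \<longleftrightarrow> w \<in> b" if "w \<in> W" for w using h that by metis
    then show "a = b" using ab XW by auto
  qed
  moreover have hW: "h a \<subseteq> W'" for a by (auto simp: h_def)
  moreover have "h {} = {}" if "{} \<in> X" using that by (intro h_eq) auto
  moreover have "h W = W'" if "W \<in> X" using that by (intro h_eq) (simp_all add: W'_def)
  moreover have "h (W - a) = W' - h a" if "a \<in> X" "W - a \<in> X" for a
    using that h by (intro h_eq) (auto simp: W'_def)
  moreover have "h (a \<inter> b) = h a \<inter> h b" if "a \<in> X" "b \<in> X" "a \<inter> b \<in> X" for a b
    using that h hW by (intro h_eq) auto
  moreover have "h (a \<union> b) = h a \<union> h b" if "a \<in> X" "b \<in> X" "a \<union> b \<in> X" for a b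
    using that h hW by (intro h_eq) auto
  ultimately have "partial_embedding (complex_algebra (W, R)) X (complex_algebra (W', R')) h"
    unfolding partial_embedding_def using h_box by (simp add: image_subset_iff)
  with circum show ?thesis by blast
qed

lemma finite_embeddability:
  fixes A :: "'a modal_algebra"
  assumes A: "A \<in> variety_K4C n" and X: "finite X" "X \<subseteq> carrier A"
  shows "\<exists>B \<in> (circum_algebras n :: nat set modal_algebra set). \<exists>h. partial_embedding A X B h"
proof -
  interpret normal_modal_algebra A using A by (simp add: variety_K4C_def)
  let ?r = "\<lambda>a. {F \<in> ultrafilters A. a \<in> F}" and ?C = "complex_algebra (canonical_frame A)"
  have R: "canonical_rel A \<subseteq> ultrafilters A \<times> ultrafilters A" by (auto simp: canonical_rel_def)
  \<comment> \<open>A valuation by representing sets lifts to \<open>A\<close>, where the axiom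
    takes the value \<open>one A\<close>; the representation carries this back to the frame.\<close>
  have C: "eval ?C \<theta> (fmC n Var) = ultrafilters A" if "range \<theta> \<subseteq> ?r ` carrier A" for \<theta>
  proof -
    define \<eta> where "\<eta> k = inv_into (carrier A) ?r (\<theta> k)" for k
    have \<theta>: "\<theta> k \<in> ?r ` carrier A" for k using that by (rule range_subsetD)
    have \<eta>: "\<eta> k \<in> carrier A" "?r (\<eta> k) = \<theta> k" for k
      unfolding \<eta>_def by (rule inv_into_into[OF \<theta>], rule f_inv_into_f[OF \<theta>])
    have \<eta>A: "range \<eta> \<subseteq> carrier A" using \<eta>(1) by blast
    have "\<theta> = ?r \<circ> \<eta>" by (rule ext) (simp only: o_apply \<eta>(2))
    then have "eval ?C \<theta> (fmC n Var) = ?r (eval A \<eta> (fmC n Var))"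
      using homomorphism_eval[OF homomorphism_canonical \<eta>A, of "fmC n Var"] by (simp only:)
    also have "eval A \<eta> (fmC n Var) = one A"
      by (rule variety_valid[OF A K4C_axioms(2) \<eta>A])
    also have "?r (one A) = one ?C"
      by (auto simp: ultrafilter_iff)
    finally show ?thesis by simp
  qed
  have "finite (?r ` X)" "?r ` X \<subseteq> ?r ` carrier A"
    using finite_imageI[OF X(1)] image_mono[OF X(2)] by this
  with C finite_partial_embedding_frame[OF R trans_canonical_rel[OF A]
      homomorphism_image_subuniverse[OF homomorphism_canonical], of n "?r ` X"]
  obtain F :: "('a set set set \<times> 'a set set set set) set \<times> _" and h where F': "F \<in> circum_frames n"
    and h': "partial_embedding ?C (?r ` X) (complex_algebra F) h" by auto
  obtain W R where WR_eq: "F = (W, R)" by (cases F)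
  note F = F'[unfolded WR_eq] and h = h'[unfolded WR_eq]
  have WR: "finite W" "R \<subseteq> W \<times> W" using F by (auto simp: circum_frames_def)
  \<comment> \<open>The worlds are pairs built from sets of sets of ultrafilters. Being finite in
    number, they can be replaced by natural numbers.\<close>
  from WR(1) obtain f :: "_ \<Rightarrow> nat" where f: "inj_on f W"
    using finite_imp_inj_to_nat_seg by metis
  have "inj_on ((`) f) (carrier (complex_algebra (W, R)))"
    using f by (simp add: inj_on_image_Pow)
  from homomorphism_partial_embedding[OF
      partial_embedding_homomorphism[OF homomorphism_canonical inj_on_canonical X(2) h]
      homomorphism_complex_image[OF WR(2) f] this]
  have "\<exists>h. partial_embedding A X (complex_algebra (f ` W, map_prod f f ` R)) h" by blast
  moreover have "complex_algebra (f ` W, map_prod f f ` R) \<in> circum_algebras n"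
    unfolding circum_algebras_def using circum_frames_image[OF F f] by (rule imageI)
  ultimately show ?thesis by (rule bexI)
qed

subsection \<open>Embedding into ultraproducts\<close>

text \<open>The sets \<open>{l. X \<subseteq> set l}\<close> for finite X generate a proper filter,
  since every finite X is the set of entries of some list. With the empty relation, the power set of
  the lists is a normal modal algebra, so \<open>ultrafilter_extension\<close> applies to
  it.\<close>

lemma ultrafilter_of_lists:
  "\<exists>U. ultrafilter_on (UNIV :: 'a list set) U \<and> (\<forall>x. eventually (\<lambda>l. x \<in> set l) U)"
proof -
  let ?P = "complex_algebra (UNIV :: 'a list set, {})"
  interpret P: normal_modal_algebra ?P by (rule normal_complex_algebra) simp
  define F where "F = {S :: 'a list set. \<exists>X. finite X \<and> {l. X \<subseteq> set l} \<subseteq> S}"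
  have FI: "S \<in> F" if "finite X" "{l. X \<subseteq> set l} \<subseteq> S" for S X
    unfolding F_def using that by blast
  have FE: "\<exists>X. finite X \<and> {l. X \<subseteq> set l} \<subseteq> S" if "S \<in> F" for S
    using that unfolding F_def by simp
  have fi: "filter_in ?P F"
    unfolding filter_in_def
  proof (intro conjI ballI impI)
    show "one ?P \<in> F" by (rule FI[of "{}"]) simp_all
    fix S S' assume "S \<in> F"
    then obtain X where X: "finite X" "{l. X \<subseteq> set l} \<subseteq> S" using FE by meson
    show "meet ?P S S' \<in> F" if S': "S' \<in> F"
    proof -
      obtain X' where "finite X'" "{l. X' \<subseteq> set l} \<subseteq> S'" using FE[OF S'] by meson
      with X show ?thesis by (intro FI[of "X \<union> X'"]) auto
    qed
    show "S' \<in> F" if "meet ?P S S' = S"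
    proof -
      have "S \<subseteq> S'" using that by auto
      with X(2) show ?thesis by (intro FI[OF X(1)]) (rule subset_trans)
    qed
  qed simp
  have zero: "zero ?P \<notin> F"
  proof
    assume "zero ?P \<in> F"
    then obtain X where "finite X" "{l. X \<subseteq> set l} \<subseteq> zero ?P" using FE by meson
    moreover obtain l where "set l = X" using \<open>finite X\<close> finite_list by meson
    ultimately show False by auto
  qed
  from P.ultrafilter_extension[OF fi zero] obtain G where G: "G \<in> ultrafilters ?P" "F \<subseteq> G"
    by (elim bexE)
  have int: "S \<inter> S' \<in> G \<longleftrightarrow> S \<in> G \<and> S' \<in> G" for S S'
    using P.ultrafilter_iff(4)[OF G(1), of S S'] by simp
  define U where "U = Abs_filter (\<lambda>Q. Collect Q \<in> G)"
  have "is_filter (\<lambda>Q. Collect Q \<in> G)"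
  proof
    show "Collect (\<lambda>x. True) \<in> G" using P.ultrafilter_iff(2)[OF G(1)] by simp
    fix Q Q'
    show "Collect (\<lambda>x. Q x \<and> Q' x) \<in> G" if "Collect Q \<in> G" "Collect Q' \<in> G"
      unfolding Collect_conj_eq int using that by simp
    show "Collect Q' \<in> G" if "\<forall>x. Q x \<longrightarrow> Q' x" "Collect Q \<in> G"
    proof -
      have "Collect Q \<inter> Collect Q' = Collect Q" using that(1) by auto
      then show ?thesis using that(2) int[of "Collect Q" "Collect Q'"] by simp
    qed
  qed
  then have ev: "eventually Q U \<longleftrightarrow> Collect Q \<in> G" for Q
    unfolding U_def by (rule eventually_Abs_filter)
  have "eventually Q U \<or> eventually (\<lambda>l. \<not> Q l) U" for Q
  proof -
    have "cmpl ?P (Collect Q) = Collect (\<lambda>l. \<not> Q l)" by auto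
    with P.ultrafilter_iff(3)[OF G(1), of "Collect Q"] show ?thesis unfolding ev by simp
  qed
  moreover have "U \<noteq> bot"
    unfolding trivial_limit_def ev using P.ultrafilter_iff(1)[OF G(1)] by simp
  moreover have "eventually (\<lambda>l. l \<in> UNIV) U"
    by simp
  ultimately have "ultrafilter_on UNIV U" unfolding ultrafilter_on_def by blast
  moreover have "eventually (\<lambda>l. x \<in> set l) U" for x
    unfolding ev by (rule subsetD[OF G(2)], rule FI[of "{x}"]) simp_all
  ultimately show ?thesis by blast
qed

text \<open>For any given arguments, almost every list contains them together with the value of the
  operation, and there the partial embedding chosen for the list respects the operation. Hence the
  equations hold between classes.\<close>

lemma ultraproduct_embedding:
  fixes A :: "'a modal_algebra" and K :: "'b modal_algebra set"
  assumes A: "algebra_closed A" and K: "\<And>B. B \<in> K \<Longrightarrow> algebra_closed B"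
    and local: "\<And>X. finite X \<Longrightarrow> X \<subseteq> carrier A \<Longrightarrow> \<exists>B \<in> K. \<exists>h. partial_embedding A X B h"
  shows "\<exists>(B :: 'a list \<Rightarrow> 'b modal_algebra) U g. range B \<subseteq> K \<and> ultrafilter_on UNIV U \<and>
    homomorphism A (ultraproduct UNIV B U) g \<and> inj_on g (carrier A)"
proof -
  obtain U :: "'a list filter" where U: "ultrafilter_on UNIV U"
    and ev: "\<And>x. eventually (\<lambda>l. x \<in> set l) U" using ultrafilter_of_lists by blast
  \<comment> \<open>A list may have entries outside the carrier, hence the intersection.\<close>
  have "\<forall>l. \<exists>B h. B \<in> K \<and> partial_embedding A (set l \<inter> carrier A) B h"
    using local by (meson finite_Int finite_set inf_le2)
  then obtain B h where B: "\<And>l. B l \<in> K"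
    and h: "\<And>l. partial_embedding A (set l \<inter> carrier A) (B l) (h l)" by metis
  have clB: "algebra_closed (B l)" for l using K B by blast
  let ?P = "product UNIV B"
  let ?q = "\<lambda>x. ultra_rel UNIV B U `` {x}"
  \<comment> \<open>At lists that miss x the value zero only keeps \<open>b x\<close> inside the
    product; the other lists form a set of the ultrafilter, so the class of \<open>b x\<close> is
    unaffected by this choice.\<close>
  define b where "b x = (\<lambda>l. if x \<in> set l then h l x else zero (B l))" for x
  note A' = A[unfolded subuniverse_def]
  have hc: "h l ` (set l \<inter> carrier A) \<subseteq> carrier (B l)" and h_inj: "inj_on (h l) (set l \<inter> carrier A)"
    and h0: "zero A \<in> set l \<Longrightarrow> h l (zero A) = zero (B l)"
      "one A \<in> set l \<Longrightarrow> h l (one A) = one (B l)"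
    and h1: "x \<in> set l \<Longrightarrow> x \<in> carrier A \<Longrightarrow> cmpl A x \<in> set l \<Longrightarrow> h l (cmpl A x) = cmpl (B l) (h l x)"
      "x \<in> set l \<Longrightarrow> x \<in> carrier A \<Longrightarrow> box A x \<in> set l \<Longrightarrow> h l (box A x) = box (B l) (h l x)"
    and h2: "x \<in> set l \<Longrightarrow> x \<in> carrier A \<Longrightarrow> y \<in> set l \<Longrightarrow> y \<in> carrier A \<Longrightarrow> meet A x y \<in> set l \<Longrightarrow>
        h l (meet A x y) = meet (B l) (h l x) (h l y)"
      "x \<in> set l \<Longrightarrow> x \<in> carrier A \<Longrightarrow> y \<in> set l \<Longrightarrow> y \<in> carrier A \<Longrightarrow> join A x y \<in> set l \<Longrightarrow>
        h l (join A x y) = join (B l) (h l x) (h l y)" for l x y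
    using h[of l] A' unfolding partial_embedding_def by simp_all
  have b: "b x \<in> carrier ?P" if "x \<in> carrier A" for x
    using that hc clB by (auto simp: b_def PiE_iff subuniverse_def subset_iff)
  have clP: "algebra_closed ?P" using clB by (intro algebra_closed_product)
  note clP' = clP[unfolded subuniverse_def]
  note q = homomorphism_ultraproduct[of UNIV B U, OF clB U, unfolded homomorphism_def]
  have eq: "?q x = ?q y" if "x \<in> carrier ?P" "y \<in> carrier ?P" "eventually (\<lambda>l. x l = y l) U" for x y
    using that by (intro equiv_class_eq[OF equiv_ultra_rel]) (simp add: ultra_rel_def)
  have "homomorphism A (ultraproduct UNIV B U) (\<lambda>x. ?q (b x))"
    unfolding homomorphism_def
  proof (intro conjI ballI)
    show "algebra_closed A" by (rule A)
    show "algebra_closed (ultraproduct UNIV B U)" using q by blast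
    show "(\<lambda>x. ?q (b x)) \<in> carrier A \<rightarrow> carrier (ultraproduct UNIV B U)" using q b by blast
    have "?q (b (zero A)) = ?q (zero ?P)"
    proof (rule eq)
      show "eventually (\<lambda>l. b (zero A) l = zero ?P l) U"
        using ev[of "zero A"] by eventually_elim (simp add: b_def h0)
    qed (use b A' clP' in blast)+
    then show "?q (b (zero A)) = zero (ultraproduct UNIV B U)" using q by simp
    have "?q (b (one A)) = ?q (one ?P)"
    proof (rule eq)
      show "eventually (\<lambda>l. b (one A) l = one ?P l) U"
        using ev[of "one A"] by eventually_elim (simp add: b_def h0)
    qed (use b A' clP' in blast)+
    then show "?q (b (one A)) = one (ultraproduct UNIV B U)" using q by simp
  next
    fix x assume x: "x \<in> carrier A"
    have "?q (b (cmpl A x)) = ?q (cmpl ?P (b x))"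
    proof (rule eq)
      show "eventually (\<lambda>l. b (cmpl A x) l = cmpl ?P (b x) l) U"
        using ev[of x] ev[of "cmpl A x"] by eventually_elim (use x in \<open>simp add: b_def h1\<close>)
    qed (use b A' clP' x in blast)+
    then show "?q (b (cmpl A x)) = cmpl (ultraproduct UNIV B U) (?q (b x))"
      using q b[OF x] by simp
    have "?q (b (box A x)) = ?q (box ?P (b x))"
    proof (rule eq)
      show "eventually (\<lambda>l. b (box A x) l = box ?P (b x) l) U"
        using ev[of x] ev[of "box A x"] by eventually_elim (use x in \<open>simp add: b_def h1\<close>)
    qed (use b A' clP' x in blast)+
    then show "?q (b (box A x)) = box (ultraproduct UNIV B U) (?q (b x))"
      using q b[OF x] by simp
    fix y assume y: "y \<in> carrier A"
    have "?q (b (meet A x y)) = ?q (meet ?P (b x) (b y))"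
    proof (rule eq)
      show "eventually (\<lambda>l. b (meet A x y) l = meet ?P (b x) (b y) l) U"
        using ev[of x] ev[of y] ev[of "meet A x y"]
        by eventually_elim (use x y in \<open>simp add: b_def h2\<close>)
    qed (use b A' clP' x y in blast)+
    then show "?q (b (meet A x y)) = meet (ultraproduct UNIV B U) (?q (b x)) (?q (b y))"
      using q b[OF x] b[OF y] by simp
    have "?q (b (join A x y)) = ?q (join ?P (b x) (b y))"
    proof (rule eq)
      show "eventually (\<lambda>l. b (join A x y) l = join ?P (b x) (b y) l) U"
        using ev[of x] ev[of y] ev[of "join A x y"]
        by eventually_elim (use x y in \<open>simp add: b_def h2\<close>)
    qed (use b A' clP' x y in blast)+
    then show "?q (b (join A x y)) = join (ultraproduct UNIV B U) (?q (b x)) (?q (b y))"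
      using q b[OF x] b[OF y] by simp
  qed
  moreover have "inj_on (\<lambda>x. ?q (b x)) (carrier A)"
  proof (rule inj_onI)
    fix x y assume xy: "x \<in> carrier A" "y \<in> carrier A" "?q (b x) = ?q (b y)"
    then have "(b x, b y) \<in> ultra_rel UNIV B U"
      using b eq_equiv_class[OF _ equiv_ultra_rel] by blast
    then have "eventually (\<lambda>l. b x l = b y l) U" by (simp add: ultra_rel_def)
    \<comment> \<open>One common list is enough for injectivity: the lists that contain x and y and
      on which the two functions agree form a set of the ultrafilter, hence exist.\<close>
    with ev[of x] ev[of y] have "eventually (\<lambda>l. x \<in> set l \<and> y \<in> set l \<and> h l x = h l y) U"
      by eventually_elim (auto simp: b_def)
    moreover have "U \<noteq> bot" using U by (simp add: ultrafilter_on_def)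
    ultimately obtain l where "x \<in> set l" "y \<in> set l" "h l x = h l y"
      using eventually_happens by blast
    then show "x = y" using h_inj[of l] xy by (auto dest: inj_onD)
  qed
  ultimately show ?thesis using B U by blast
qed

section \<open>The class operators and the variety\<close>

lemma variety_S:
  assumes "K \<subseteq> variety_K4C n"
  shows "\<^bold>S K \<subseteq> variety_K4C n"
proof
  fix B assume "B \<in> \<^bold>S K"
  then obtain A X h where A: "A \<in> K" "subuniverse X A"
    and h: "homomorphism B (A\<lparr>carrier := X\<rparr>) h" "bij_betw h (carrier B) X"
    by (auto simp: class_S_def isomorphic_def)
  have AV: "A \<in> variety_K4C n" using A assms by blast
  have "homomorphism B A (id \<circ> h)"
    using h(1) homomorphism_inclusion[OF A(2) algebra_closed_normal[OF AV]]
    by (rule homomorphism_comp)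
  moreover have "inj_on (id \<circ> h) (carrier B)" using h(2) by (simp add: bij_betw_def)
  ultimately show "B \<in> variety_K4C n" using variety_embedding[OF AV] by blast
qed

lemma circum_algebras_subset_variety: "circum_algebras n \<subseteq> variety_K4C n"
  using complex_algebra_in_variety by (auto simp: circum_algebras_def)

lemma HSP_subset_variety: "\<^bold>H (\<^bold>S (\<^bold>P (circum_algebras n))) \<subseteq> variety_K4C n"
proof -
  have "\<^bold>P (circum_algebras n) \<subseteq> variety_K4C n"
    using circum_algebras_subset_variety by (fastforce simp: class_P_def intro!: variety_product)
  from variety_S[OF this] show ?thesis
    unfolding class_H_def by (auto intro: variety_homomorphic_image)
qed

lemma SPU_subset_variety: "\<^bold>S (\<^bold>P\<^sub>U (circum_algebras n)) \<subseteq> variety_K4C n"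
proof (rule variety_S)
  show "\<^bold>P\<^sub>U (circum_algebras n) \<subseteq> variety_K4C n"
    using circum_algebras_subset_variety by (fastforce simp: class_PU_def intro!: variety_ultraproduct)
qed

text \<open>Pull the copy of A in the ultraproduct back to the product: the elements whose class
  lies in the range of g form a subalgebra, and taking the class followed by the inverse of g maps
  it onto A.\<close>

lemma embedding_in_ultraproduct_HSP:
  fixes B :: "'i \<Rightarrow> 'b modal_algebra"
  assumes g: "homomorphism A (ultraproduct I B U) g" "inj_on g (carrier A)"
    and B: "\<And>i. i \<in> I \<Longrightarrow> B i \<in> K" "\<And>i. i \<in> I \<Longrightarrow> algebra_closed (B i)" and U: "ultrafilter_on I U"
  shows "A \<in> \<^bold>H (\<^bold>S (\<^bold>P K :: ('i \<Rightarrow> 'b) modal_algebra set) :: ('i \<Rightarrow> 'b) modal_algebra set)"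
proof -
  let ?P = "product I B" and ?Q = "ultraproduct I B U"
  let ?q = "\<lambda>x. ultra_rel I B U `` {x}"
  have q: "homomorphism ?P ?Q ?q" using B(2) U by (rule homomorphism_ultraproduct)
  have Q: "carrier ?Q = ?q ` carrier ?P" using B(2) U by (rule ultraproduct_simps(1))
  note q' = q[unfolded homomorphism_def] and g' = g(1)[unfolded homomorphism_def]
  have im: "subuniverse (g ` carrier A) ?Q" by (rule homomorphism_image_subuniverse[OF g(1)])
  let ?X = "{x \<in> carrier ?P. ?q x \<in> g ` carrier A}"
  have sub: "subuniverse ?X ?P"
    using q' im unfolding subuniverse_def by (auto simp del: product_simps)
  have clP: "algebra_closed ?P" using q' by blast
  have idi: "isomorphic (?P\<lparr>carrier := ?X\<rparr>) (?P\<lparr>carrier := ?X\<rparr>)"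
    unfolding isomorphic_def using homomorphism_inclusion[OF sub clP]
    by (intro exI[of _ id]) (auto simp: homomorphism_def simp del: product_simps)
  have "?P \<in> \<^bold>P K" using B by (auto simp: class_P_def)
  then have inS: "?P\<lparr>carrier := ?X\<rparr> \<in> \<^bold>S (\<^bold>P K :: ('i \<Rightarrow> 'b) modal_algebra set)"
    using sub idi unfolding class_S_def by blast
  let ?k = "\<lambda>x. inv_into (carrier A) g (?q x)"
  have k: "?k x \<in> carrier A" "g (?k x) = ?q x" if "x \<in> ?X" for x
    using that by (auto simp: inv_into_into f_inv_into_f)
  \<comment> \<open>Injectivity of g turns each homomorphism equation for ?k into an equation
    between classes in the ultraproduct, where g and the quotient map are already known to preserve
    the operations.\<close>
  have kI: "?k x = a" if "a \<in> carrier A" "?q x = g a" for x a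
    using that g(2) by (simp add: inv_into_f_f)
  note subX = sub[unfolded subuniverse_def]
  note clA = g'[THEN conjunct1, unfolded subuniverse_def]
  have "homomorphism (?P\<lparr>carrier := ?X\<rparr>) A ?k"
    unfolding homomorphism_def
  proof (intro conjI ballI)
    show "algebra_closed (?P\<lparr>carrier := ?X\<rparr>)" using sub by (simp add: subuniverse_def)
    show "algebra_closed A" using g' by blast
    show "?k \<in> carrier (?P\<lparr>carrier := ?X\<rparr>) \<rightarrow> carrier A" using k by (simp del: product_simps)
    show "?k (zero (?P\<lparr>carrier := ?X\<rparr>)) = zero A" "?k (one (?P\<lparr>carrier := ?X\<rparr>)) = one A"
      using q' g' clA by (intro kI; simp del: product_simps)+
    fix x assume "x \<in> carrier (?P\<lparr>carrier := ?X\<rparr>)"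
    then have x: "x \<in> ?X" by simp
    then show "?k (cmpl (?P\<lparr>carrier := ?X\<rparr>) x) = cmpl A (?k x)"
      "?k (box (?P\<lparr>carrier := ?X\<rparr>) x) = box A (?k x)"
      using q' g' clA k[OF x] by (intro kI; simp del: product_simps)+
    fix y assume "y \<in> carrier (?P\<lparr>carrier := ?X\<rparr>)"
    then have y: "y \<in> ?X" by simp
    show "?k (meet (?P\<lparr>carrier := ?X\<rparr>) x y) = meet A (?k x) (?k y)"
      "?k (join (?P\<lparr>carrier := ?X\<rparr>) x y) = join A (?k x) (?k y)"
      using q' g' clA k[OF x] k[OF y] x y by (intro kI; simp del: product_simps)+
  qed
  moreover have "?k ` carrier (?P\<lparr>carrier := ?X\<rparr>) = carrier A"
  proof
    show "?k ` carrier (?P\<lparr>carrier := ?X\<rparr>) \<subseteq> carrier A" using k by (auto simp del: product_simps)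
    show "carrier A \<subseteq> ?k ` carrier (?P\<lparr>carrier := ?X\<rparr>)"
    proof
      fix a assume a: "a \<in> carrier A"
      then have "g a \<in> ?q ` carrier ?P" using g' Q by blast
      then obtain x where x: "x \<in> carrier ?P" "g a = ?q x" by blast
      then have "x \<in> ?X" using a by auto
      then have "x \<in> carrier (?P\<lparr>carrier := ?X\<rparr>)" by simp
      moreover have "a = ?k x" by (rule kI[OF a x(2)[symmetric], symmetric])
      ultimately show "a \<in> ?k ` carrier (?P\<lparr>carrier := ?X\<rparr>)"
        by - (rule image_eqI[where x = x])
    qed
  qed
  ultimately show ?thesis using inS unfolding class_H_def by blast
qed

theorem theorem9p2:
  fixes n :: nat
  shows
    "(variety_K4C n :: 'a modal_algebra set)
        = \<^bold>H (\<^bold>S (\<^bold>P (circum_algebras n :: nat set modal_algebra set)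
              :: ('a list \<Rightarrow> nat set) modal_algebra set)
            :: ('a list \<Rightarrow> nat set) modal_algebra set)
     \<and> (variety_K4C n :: 'a modal_algebra set)
        = \<^bold>S (\<^bold>P\<^sub>U (circum_algebras n :: nat set modal_algebra set)
            :: ('a list \<Rightarrow> nat set) set modal_algebra set)
     \<and> \<^bold>H (\<^bold>S (\<^bold>P (circum_algebras n :: 'w set modal_algebra set)
              :: ('i \<Rightarrow> 'w set) modal_algebra set)
            :: 's modal_algebra set)
        \<subseteq> (variety_K4C n :: 'a modal_algebra set)
     \<and> \<^bold>S (\<^bold>P\<^sub>U (circum_algebras n :: 'w set modal_algebra set)
            :: ('i \<Rightarrow> 'w set) set modal_algebra set)
        \<subseteq> (variety_K4C n :: 'a modal_algebra set)
     \<and> (\<forall>A \<in> (variety_K4C n :: 'a modal_algebra set).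
          \<exists>B \<in> (\<^bold>P\<^sub>U (circum_algebras n :: nat set modal_algebra set)
                  :: ('a list \<Rightarrow> nat set) set modal_algebra set).
            \<exists>X. subuniverse X B \<and> isomorphic A (B\<lparr>carrier := X\<rparr>))"
proof (intro conjI)
  \<comment> \<open>Both equalities rest on this one embedding: its range gives the subalgebra of
    the ultraproduct, its pullback the subalgebra of the product.\<close>
  have emb: "\<exists>(B :: 'a list \<Rightarrow> nat set modal_algebra) U g. range B \<subseteq> circum_algebras n \<and>
      ultrafilter_on UNIV U \<and> homomorphism A (ultraproduct UNIV B U) g \<and> inj_on g (carrier A)"
    if "A \<in> variety_K4C n" for A :: "'a modal_algebra"
  proof (rule ultraproduct_embedding)
    show "algebra_closed A" using that by (rule algebra_closed_normal)
    show "algebra_closed B" if "B \<in> circum_algebras n" for B :: "nat set modal_algebra"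
      using subsetD[OF circum_algebras_subset_variety that] by (rule algebra_closed_normal)
    show "\<exists>B \<in> (circum_algebras n :: nat set modal_algebra set). \<exists>h. partial_embedding A X B h"
      if "finite X" "X \<subseteq> carrier A" for X
      using \<open>A \<in> variety_K4C n\<close> that by (rule finite_embeddability)
  qed
  show PU: "\<forall>A \<in> (variety_K4C n :: 'a modal_algebra set).
      \<exists>B \<in> (\<^bold>P\<^sub>U (circum_algebras n :: nat set modal_algebra set)
              :: ('a list \<Rightarrow> nat set) set modal_algebra set).
        \<exists>X. subuniverse X B \<and> isomorphic A (B\<lparr>carrier := X\<rparr>)"
  proof
    fix A :: "'a modal_algebra" assume "A \<in> variety_K4C n"
    from emb[OF this] obtain B :: "'a list \<Rightarrow> nat set modal_algebra" and U g
      where B: "range B \<subseteq> circum_algebras n" "ultrafilter_on UNIV U"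
        and g: "homomorphism A (ultraproduct UNIV B U) g" "inj_on g (carrier A)"
      by blast
    have "ultraproduct UNIV B U \<in> \<^bold>P\<^sub>U (circum_algebras n)"
      unfolding class_PU_def using B
      by (intro CollectI exI[of _ UNIV] exI[of _ B] exI[of _ U] conjI refl ballI range_subsetD[of B])
    then show "\<exists>B \<in> (\<^bold>P\<^sub>U (circum_algebras n :: nat set modal_algebra set)
              :: ('a list \<Rightarrow> nat set) set modal_algebra set).
        \<exists>X. subuniverse X B \<and> isomorphic A (B\<lparr>carrier := X\<rparr>)"
      using homomorphism_image_subuniverse[OF g(1)] embedding_isomorphic[OF g]
      by (intro bexI exI conjI)
  qed
  show "(variety_K4C n :: 'a modal_algebra set)
        = \<^bold>S (\<^bold>P\<^sub>U (circum_algebras n :: nat set modal_algebra set)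
            :: ('a list \<Rightarrow> nat set) set modal_algebra set)"
  proof (rule equalityI[OF subsetI SPU_subset_variety])
    fix A :: "'a modal_algebra" assume "A \<in> variety_K4C n"
    then show "A \<in> \<^bold>S (\<^bold>P\<^sub>U (circum_algebras n :: nat set modal_algebra set)
            :: ('a list \<Rightarrow> nat set) set modal_algebra set)"
      unfolding class_S_def by (intro CollectI bspec[OF PU])
  qed
  show "(variety_K4C n :: 'a modal_algebra set)
        = \<^bold>H (\<^bold>S (\<^bold>P (circum_algebras n :: nat set modal_algebra set)
              :: ('a list \<Rightarrow> nat set) modal_algebra set)
            :: ('a list \<Rightarrow> nat set) modal_algebra set)"
  proof (intro equalityI subsetI)
    fix A :: "'a modal_algebra" assume "A \<in> variety_K4C n"
    from emb[OF this] obtain B :: "'a list \<Rightarrow> nat set modal_algebra" and U g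
      where B: "range B \<subseteq> circum_algebras n" "ultrafilter_on UNIV U"
        and g: "homomorphism A (ultraproduct UNIV B U) g" "inj_on g (carrier A)"
      by blast
    have BK: "B l \<in> circum_algebras n" for l using B(1) by (rule range_subsetD)
    have "algebra_closed (B l)" for l
      using subsetD[OF circum_algebras_subset_variety BK] by (rule algebra_closed_normal)
    then show "A \<in> \<^bold>H (\<^bold>S (\<^bold>P (circum_algebras n :: nat set modal_algebra set)
              :: ('a list \<Rightarrow> nat set) modal_algebra set)
            :: ('a list \<Rightarrow> nat set) modal_algebra set)"
      by (intro embedding_in_ultraproduct_HSP[OF g BK _ B(2)])
  qed (rule subsetD[OF HSP_subset_variety])
qed (rule HSP_subset_variety, rule SPU_subset_variety)

end
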